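(* Let $G$ be a finite undirected connected multigraph (possibly with loops) and let $e$ be an edge of $G$ between two distinct vertices $v_1$ and $v_2$ that is not a bridge. Then for every integer $k$, $$\mathcal{A}_k(G)+\mathcal{A}_{k-1}(G/e)=\mathcal{A}_k(G/e)+\mathcal{A}_k(G\setminus e).$$
   Context: $G/e$ is obtained from $G$ by merging $v_1$ and $v_2$ into one vertex $v_{1,2}$; the other edges between $v_1$ and $v_2$ (if $e$ has multiplicity $m_e$, there are $m_e-1$ of them) become loops at $v_{1,2}$, and loops of $G$ are kept. $G\setminus e$ is obtained by deleting only the edge $e$. Let $H$ be a connected multigraph with $n$ vertices, $\ell$ loops and $m$ non-loop edges. A connected $r$-partition of $H$ is a partition $\Pi=\{V_1,\dots,V_r\}$ of the vertex set into $r$ nonempty parts such that each part induces a connected subgraph. Its connected partition graph is the loopless multigraph with vertex set $\Pi$ and with $\sum_{u\in V_a,w\in V_b}a_{u,w}$ edges between $V_a$ and $V_b$ ($a\neq b$), where $a_{u,w}$ is the number of edges of $H$ between $u$ and $w$. The number $\beta_{i,j+\ell}(H)$ is the total number of acyclic orientations on connected partition graphs of $H$ with $n-i$ vertices and $m-j$ edges having a unique sink at the part containing a fixed vertex of $H$ (the number does not depend on the fixed vertex; parallel edges are directed the same way in an acyclic orientation). The $k$-th alternating number of $H$ is $\mathcal{A}_k(H)=\sum_i(-1)^i\beta_{i,k}(H)$. *)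

theory Defs
  imports Main "HOL-Library.FuncSet" "HOL-Library.Disjoint_Sets"
begin

text \<open>Undirected multigraphs: every edge has its own identity, so parallel edges are distinct
  edges with the same set of end points, and a loop has a single end point.\<close>

record ('v, 'e) multigraph =
  verts :: "'v set"
  edges :: "'e set"
  ends :: "'e \<Rightarrow> 'v set"

locale finite_multigraph =
  fixes G :: "('v, 'e) multigraph"
  assumes finite_verts: "finite (verts G)"
    and finite_edges: "finite (edges G)"
    and ends_wf: "f \<in> edges G \<Longrightarrow> \<exists>u \<in> verts G. \<exists>w \<in> verts G. ends G f = {u, w}"

definition loops :: "('v, 'e) multigraph \<Rightarrow> 'e set" where
  "loops G = {f \<in> edges G. card (ends G f) = 1}"

definition non_loops :: "('v, 'e) multigraph \<Rightarrow> 'e set" where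
  "non_loops G = {f \<in> edges G. card (ends G f) = 2}"

definition adj :: "('v, 'e) multigraph \<Rightarrow> ('v \<times> 'v) set" where
  "adj G = {(u, w). \<exists>f \<in> edges G. ends G f = {u, w}}"

definition connected_mg :: "('v, 'e) multigraph \<Rightarrow> bool" where
  "connected_mg G \<longleftrightarrow> verts G \<noteq> {} \<and> (\<forall>u \<in> verts G. \<forall>w \<in> verts G. (u, w) \<in> (adj G)\<^sup>*)"

definition induced :: "('v, 'e) multigraph \<Rightarrow> 'v set \<Rightarrow> ('v, 'e) multigraph" where
  "induced G W = \<lparr>verts = W, edges = {f \<in> edges G. ends G f \<subseteq> W}, ends = ends G\<rparr>"

definition delete_edge :: "('v, 'e) multigraph \<Rightarrow> 'e \<Rightarrow> ('v, 'e) multigraph" where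
  "delete_edge G e = G\<lparr>edges := edges G - {e}\<rparr>"

text \<open>Here \<open>x\<close> is the name of the merged vertex; it may be an end point of \<open>e\<close> or any element
  that is not a vertex of \<open>G\<close>. Edges parallel to \<open>e\<close> become loops at \<open>x\<close>.\<close>

definition contract_edge :: "('v, 'e) multigraph \<Rightarrow> 'e \<Rightarrow> 'v \<Rightarrow> ('v, 'e) multigraph" where
  "contract_edge G e x =
    \<lparr>verts = insert x (verts G - ends G e),
     edges = edges G - {e},
     ends = (\<lambda>f. (\<lambda>v. if v \<in> ends G e then x else v) ` ends G f)\<rparr>"

definition bridge :: "('v, 'e) multigraph \<Rightarrow> 'e \<Rightarrow> bool" where
  "bridge G e \<longleftrightarrow> e \<in> edges G \<and>
    (\<exists>u \<in> verts G. \<exists>w \<in> verts G. (u, w) \<in> (adj G)\<^sup>* \<and> (u, w) \<notin> (adj (delete_edge G e))\<^sup>*)"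

definition connected_partition :: "('v, 'e) multigraph \<Rightarrow> 'v set set \<Rightarrow> bool" where
  "connected_partition G P \<longleftrightarrow>
    partition_on (verts G) P \<and> (\<forall>W \<in> P. connected_mg (induced G W))"

text \<open>The edges of the partition graph are the edges of \<open>G\<close> that are not inside a part, so the
  number of edges between two parts is the number of edges of \<open>G\<close> between their vertices.\<close>

definition partition_graph :: "('v, 'e) multigraph \<Rightarrow> 'v set set \<Rightarrow> ('v set, 'e) multigraph" where
  "partition_graph G P =
    \<lparr>verts = P,
     edges = {f \<in> edges G. \<not> (\<exists>W \<in> P. ends G f \<subseteq> W)},
     ends = (\<lambda>f. {W \<in> P. W \<inter> ends G f \<noteq> {}})\<rparr>"

text \<open>An orientation assigns to every edge a pair (tail, head).\<close>

definition orientations :: "('v, 'e) multigraph \<Rightarrow> ('e \<Rightarrow> 'v \<times> 'v) set" where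
  "orientations G = (\<Pi>\<^sub>E f \<in> edges G. {(u, w). ends G f = {u, w}})"

text \<open>Two parallel edges directed in opposite ways form a directed cycle, so in an acyclic
  orientation parallel edges are directed the same way.\<close>

definition acyclic_orientations :: "('v, 'e) multigraph \<Rightarrow> ('e \<Rightarrow> 'v \<times> 'v) set" where
  "acyclic_orientations G = {d \<in> orientations G. acyclic (d ` edges G)}"

definition sinks :: "('v, 'e) multigraph \<Rightarrow> ('e \<Rightarrow> 'v \<times> 'v) \<Rightarrow> 'v set" where
  "sinks G d = {v \<in> verts G. \<forall>f \<in> edges G. fst (d f) \<noteq> v}"

text \<open>\<open>beta G q i k\<close> is \<open>\<beta>\<^bsub>i,k\<^esub>(G)\<close>, computed with the fixed vertex \<open>q\<close>. Its second index is
  \<open>k = j + card (loops G)\<close>, i.e. \<open>j = k - card (loops G)\<close>.\<close>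

definition beta :: "('v, 'e) multigraph \<Rightarrow> 'v \<Rightarrow> nat \<Rightarrow> int \<Rightarrow> nat" where
  "beta G q i k = card {(P, d).
     connected_partition G P \<and>
     int (card P) = int (card (verts G)) - int i \<and>
     int (card (edges (partition_graph G P))) =
       int (card (non_loops G)) - (k - int (card (loops G))) \<and>
     d \<in> acyclic_orientations (partition_graph G P) \<and>
     (\<exists>W. q \<in> W \<and> sinks (partition_graph G P) d = {W})}"

text \<open>A partition has between \<open>0\<close> and \<open>card (verts G)\<close> parts, so \<open>beta G q i k = 0\<close> for all
  other \<open>i\<close>.\<close>

definition alternating_number :: "('v, 'e) multigraph \<Rightarrow> 'v \<Rightarrow> int \<Rightarrow> int" where
  "alternating_number G q k = (\<Sum>i = 0..card (verts G). (-1) ^ i * int (beta G q i k))"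

end

theory Submission
  imports Defs
begin

text \<open>The number of acyclic orientations whose only sink is \<open>u\<close> satisfies a recurrence along an edge
  \<open>e = uv\<close>: such an orientation directs \<open>e\<close> from \<open>v\<close> to \<open>u\<close>, and once \<open>e\<close> is removed its sinks are
  either \<open>{u}\<close> or \<open>{u, v}\<close>. Root independence follows by induction on the number of edges, so every
  alternating number is a signed sum over connected partitions in which the root can be placed
  at \<open>e\<close>.

  Call a partition joining if \<open>e\<close> lies inside a part. Joining connected partitions of \<open>G\<close> correspond to
  the connected partitions of \<open>G/e\<close>, with one inner edge less and the opposite sign; this removes their
  contribution to \<open>A\<^sub>k(G) + A\<^sub>k\<^sub>-\<^sub>1(G/e)\<close>, and those that stay connected in \<open>G \ e\<close> cancel in
  \<open>A\<^sub>k(G/e) + A\<^sub>k(G \ e)\<close>. For a non-joining partition the recurrence leaves the orientations with two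
  sinks at the ends of \<open>e\<close>. These exist only if \<open>e\<close> is the only edge between the two parts, and merging
  the two sinks turns them into the orientations counted by the joining partitions that become
  disconnected in \<open>G \ e\<close>.\<close>

section \<open>Acyclic orientations with a prescribed set of sinks\<close>

text \<open>Whole sink sets are allowed because deleting an edge at the root may turn its other end
  into a second sink.\<close>

definition sink_orientations :: "('v, 'e) multigraph \<Rightarrow> 'v set \<Rightarrow> ('e \<Rightarrow> 'v \<times> 'v) set" where
  "sink_orientations H S = {d \<in> acyclic_orientations H. sinks H d = S}"

lemma orientation_ends:
  assumes "d \<in> orientations H" "f \<in> edges H"
  shows "ends H f = {fst (d f), snd (d f)}"
  using assms by (auto simp: orientations_def PiE_iff split: prod.splits)

lemma orientationI:
  assumes "d \<in> extensional (edges H)"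
    and "\<And>f. f \<in> edges H \<Longrightarrow> ends H f = {fst (d f), snd (d f)}"
  shows "d \<in> orientations H"
  using assms by (auto simp: orientations_def PiE_iff split: prod.splits)

lemma finite_multigraph_finite_ends:
  assumes "finite_multigraph H" "f \<in> edges H"
  shows "finite (ends H f)"
  using finite_multigraph.ends_wf[OF assms] by auto

lemma finite_multigraph_ends_subset:
  assumes "finite_multigraph H" "f \<in> edges H"
  shows "ends H f \<subseteq> verts H"
  using finite_multigraph.ends_wf[OF assms] by auto

lemma finite_orientations:
  assumes "finite_multigraph H"
  shows "finite (orientations H)"
  unfolding orientations_def
proof (rule finite_PiE)
  show "finite (edges H)" using assms by (rule finite_multigraph.finite_edges)
  fix f assume "f \<in> edges H"
  then have "finite (ends H f \<times> ends H f)"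
    using finite_multigraph_finite_ends[OF assms] by simp
  then show "finite {(u, w). ends H f = {u, w}}"
    by (rule rev_finite_subset) auto
qed

lemma finite_sink_orientations:
  assumes "finite_multigraph H"
  shows "finite (sink_orientations H S)"
  using finite_orientations[OF assms]
  by (rule rev_finite_subset) (auto simp: sink_orientations_def acyclic_orientations_def)

lemma sink_orientationsD:
  assumes "d \<in> sink_orientations H S"
  shows "d \<in> orientations H" "acyclic (d ` edges H)" "sinks H d = S"
  using assms by (auto simp: sink_orientations_def acyclic_orientations_def)

lemma sink_orientationsI:
  assumes "d \<in> orientations H" "acyclic (d ` edges H)" "sinks H d = S"
  shows "d \<in> sink_orientations H S"
  using assms by (auto simp: sink_orientations_def acyclic_orientations_def)

lemma not_fst_sink:
  assumes "d \<in> sink_orientations H S" "f \<in> edges H"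
  shows "fst (d f) \<notin> S"
  using sink_orientationsD(3)[OF assms(1)] assms(2) by (auto simp: sinks_def)

lemma sink_orientation_nonsink:
  assumes "d \<in> sink_orientations H S" "v \<in> verts H" "v \<notin> S"
  obtains f where "f \<in> edges H" "fst (d f) = v"
  using sink_orientationsD(3)[OF assms(1)] assms(2,3) by (auto simp: sinks_def)

lemma finite_multigraph_delete_edge:
  assumes "finite_multigraph H"
  shows "finite_multigraph (delete_edge H e)"
  using assms by (auto simp: finite_multigraph_def delete_edge_def)

lemma delete_edge_simps [simp]:
  "verts (delete_edge H e) = verts H"
  "edges (delete_edge H e) = edges H - {e}"
  "ends (delete_edge H e) = ends H"
  by (simp_all add: delete_edge_def)

text \<open>An edge at the sink \<open>u\<close> must point into it. Removing it takes an outgoing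
  arc from \<open>v\<close> only, so \<open>v\<close> is the only possible new sink.\<close>

lemma restrict_sink_orientation:
  assumes d: "d \<in> sink_orientations H {u}" and e: "e \<in> edges H"
    and ends: "ends H e = {u, v}"
  defines "d' \<equiv> restrict d (edges H - {e})"
  shows "d e = (v, u)"
    and "d' \<in> sink_orientations (delete_edge H e) {u}
      \<union> sink_orientations (delete_edge H e) {u, v}"
proof -
  note D = sink_orientationsD[OF d]
  have "fst (d e) \<noteq> u" using not_fst_sink[OF d e] by simp
  then show de: "d e = (v, u)"
    using orientation_ends[OF D(1) e] ends by (auto simp: doubleton_eq_iff prod_eq_iff)
  have "d' \<in> orientations (delete_edge H e)"
    by (rule orientationI) (use orientation_ends[OF D(1)] in \<open>auto simp: d'_def\<close>)
  moreover have "acyclic (d' ` edges (delete_edge H e))"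
    by (rule acyclic_subset[OF D(2)]) (auto simp: d'_def)
  moreover have "sinks (delete_edge H e) d' = {u} \<or> sinks (delete_edge H e) d' = {u, v}"
  proof -
    have "{u} \<subseteq> sinks (delete_edge H e) d'"
      using D(3) by (auto simp: sinks_def d'_def)
    moreover have "sinks (delete_edge H e) d' \<subseteq> {u, v}"
    proof
      fix w assume w: "w \<in> sinks (delete_edge H e) d'"
      show "w \<in> {u, v}"
      proof (rule ccontr)
        assume "w \<notin> {u, v}"
        then obtain f where "f \<in> edges H" "fst (d f) = w"
          using sink_orientation_nonsink[OF d, of w] w by (auto simp: sinks_def)
        then show False
          using w de \<open>w \<notin> {u, v}\<close> by (cases "f = e") (auto simp: sinks_def d'_def)
      qed
    qed
    ultimately show ?thesis by auto
  qed
  ultimately show "d' \<in> sink_orientations (delete_edge H e) {u}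
      \<union> sink_orientations (delete_edge H e) {u, v}"
    by (auto simp: sink_orientations_def acyclic_orientations_def)
qed

text \<open>No arc leaves \<open>u\<close>, so no path leads from \<open>u\<close> back to
  \<open>v\<close> and the new arc closes no cycle. It gives \<open>v\<close> an outgoing arc, so
  \<open>v\<close> is no longer a sink in case it was one.\<close>

lemma extend_sink_orientation:
  assumes d: "d \<in> sink_orientations (delete_edge H e) S" and S: "S = {u} \<or> S = {u, v}"
    and e: "e \<in> edges H" and ends: "ends H e = {u, v}" and "u \<noteq> v" and "u \<in> verts H"
  shows "d(e := (v, u)) \<in> sink_orientations H {u}"
proof (rule sink_orientationsI)
  note D = sink_orientationsD[OF d]
  let ?d = "d(e := (v, u))"
  show "?d \<in> orientations H"
  proof (rule orientationI)
    show "?d \<in> extensional (edges H)"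
      using D(1) e by (auto simp: orientations_def PiE_iff extensional_def)
    fix f assume "f \<in> edges H"
    then show "ends H f = {fst (?d f), snd (?d f)}"
      using orientation_ends[OF D(1), of f] ends by auto
  qed
  have no_out: "(u, w) \<notin> d ` (edges H - {e})" for w
  proof
    assume "(u, w) \<in> d ` (edges H - {e})"
    then obtain f where "f \<in> edges (delete_edge H e)" "fst (d f) = u"
      by (metis delete_edge_simps(2) fst_conv imageE)
    then show False using not_fst_sink[OF d] S by auto
  qed
  have "(u, v) \<notin> (d ` (edges H - {e}))\<^sup>*"
    using \<open>u \<noteq> v\<close> no_out by (meson converse_rtranclE)
  moreover have "?d ` edges H = insert (v, u) (d ` (edges H - {e}))"
    using e by auto
  ultimately show "acyclic (?d ` edges H)"
    using D(2) by (simp add: acyclic_insert)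
  have "sinks H ?d = sinks (delete_edge H e) d - {v}"
    using e by (auto simp: sinks_def)
  then show "sinks H ?d = {u}"
    using D(3) S \<open>u \<noteq> v\<close> by auto
qed

text \<open>The right-hand side is symmetric in \<open>u\<close> and \<open>v\<close> up to the root of the first summand, which
  is what makes root independence go through by induction on the number of edges.\<close>

lemma card_sink_orientations_delete_edge:
  assumes H: "finite_multigraph H" and e: "e \<in> edges H" and ends: "ends H e = {u, v}"
    and "u \<noteq> v"
  shows "card (sink_orientations H {u}) =
    card (sink_orientations (delete_edge H e) {u}) +
    card (sink_orientations (delete_edge H e) {u, v})"
proof -
  let ?A = "sink_orientations (delete_edge H e) {u}"
  let ?B = "sink_orientations (delete_edge H e) {u, v}"
  have u: "u \<in> verts H" using finite_multigraph_ends_subset[OF H e] ends by auto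
  have "bij_betw (\<lambda>d. restrict d (edges H - {e})) (sink_orientations H {u}) (?A \<union> ?B)"
  proof (rule bij_betw_byWitness[where f' = "\<lambda>d. d(e := (v, u))"])
    show "\<forall>d\<in>sink_orientations H {u}. (restrict d (edges H - {e}))(e := (v, u)) = d"
    proof
      fix d assume d: "d \<in> sink_orientations H {u}"
      \<comment> \<open>Orientations are extensional; this default value makes the two functions
        agree off the edge set too.\<close>
      have "d f = undefined" if "f \<notin> edges H" for f
        using sink_orientationsD(1)[OF d] that by (auto simp: orientations_def)
      then show "(restrict d (edges H - {e}))(e := (v, u)) = d"
        using restrict_sink_orientation(1)[OF d e ends] by (auto simp: fun_eq_iff)
    qed
    show "\<forall>d\<in>?A \<union> ?B. restrict (d(e := (v, u))) (edges H - {e}) = d"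
    proof
      fix d assume "d \<in> ?A \<union> ?B"
      then have "d \<in> orientations (delete_edge H e)"
        using sink_orientationsD(1) by blast
      then have "d f = undefined" if "f \<notin> edges H - {e}" for f
        using that by (auto simp: orientations_def)
      then show "restrict (d(e := (v, u))) (edges H - {e}) = d"
        by (auto simp: fun_eq_iff)
    qed
    show "(\<lambda>d. restrict d (edges H - {e})) ` sink_orientations H {u} \<subseteq> ?A \<union> ?B"
      using restrict_sink_orientation(2)[OF _ e ends] by blast
    show "(\<lambda>d. d(e := (v, u))) ` (?A \<union> ?B) \<subseteq> sink_orientations H {u}"
      using extend_sink_orientation[OF _ _ e ends \<open>u \<noteq> v\<close> u] by blast
  qed
  then have "card (sink_orientations H {u}) = card (?A \<union> ?B)"
    by (rule bij_betw_same_card)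
  also have "\<dots> = card ?A + card ?B"
  proof (rule card_Un_disjoint)
    show "finite ?A" "finite ?B"
      by (rule finite_sink_orientations[OF finite_multigraph_delete_edge[OF H]])+
    show "?A \<inter> ?B = {}"
      using \<open>u \<noteq> v\<close> by (auto simp: sink_orientations_def)
  qed
  finally show ?thesis .
qed

section \<open>Independence of the root\<close>

lemma sym_adj: "sym (adj H)"
  by (auto simp: adj_def sym_def insert_commute)

lemma adj_rtrancl_sym: "(u, w) \<in> (adj H)\<^sup>* \<Longrightarrow> (w, u) \<in> (adj H)\<^sup>*"
  by (meson sym_adj sym_rtrancl symE)

text \<open>Some arc leaves every vertex other than \<open>u\<close>, and in a finite acyclic
  digraph a walk along arcs must stop, which it can only do at \<open>u\<close>. Needed for roots in
  different components, where both counts are zero.\<close>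

lemma unique_sink_reachable:
  assumes H: "finite_multigraph H" and d: "d \<in> sink_orientations H {u}" and "v \<in> verts H"
  shows "(v, u) \<in> (adj H)\<^sup>*"
proof -
  note D = sink_orientationsD[OF d]
  have "finite (d ` edges H)"
    using finite_multigraph.finite_edges[OF H] by simp
  \<comment> \<open>On the converse relation the induction hypothesis speaks about the heads of arcs
    leaving \<open>v\<close>.\<close>
  then have "wf ((d ` edges H)\<inverse>)"
    using D(2) by (rule finite_acyclic_wf_converse)
  then show ?thesis
    using \<open>v \<in> verts H\<close>
  proof (induction v rule: wf_induct_rule)
    case (less v)
    show ?case
    proof (cases "v = u")
      case False
      then obtain f where f: "f \<in> edges H" "fst (d f) = v"
        using sink_orientation_nonsink[OF d less.prems] by auto
      define w where "w = snd (d f)"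
      have "(v, w) \<in> d ` edges H"
        using f by (force simp: w_def)
      moreover have ends: "ends H f = {v, w}"
        using orientation_ends[OF D(1) f(1)] f(2) by (simp add: w_def)
      moreover have "w \<in> verts H"
        using finite_multigraph_ends_subset[OF H f(1)] ends by auto
      ultimately have "(w, u) \<in> (adj H)\<^sup>*"
        using less.IH by simp
      moreover have "(v, w) \<in> adj H"
        using f(1) ends by (auto simp: adj_def)
      ultimately show ?thesis by (rule converse_rtrancl_into_rtrancl[rotated])
    qed simp
  qed
qed

text \<open>For adjacent roots, the recurrence along an edge \<open>f\<close> joining them gives
  both counts the same two-sink summand, while the one-sink summands agree by induction on the
  number of edges. Equality then spreads along paths.\<close>

lemma card_unique_sink_root_independent:
  assumes "finite_multigraph H" "u \<in> verts H" "v \<in> verts H"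
  shows "card (sink_orientations H {u}) = card (sink_orientations H {v})"
  using assms
proof (induction "card (edges H)" arbitrary: H u v rule: less_induct)
  case less
  note H = less.prems(1)
  show ?case
  proof (cases "(u, v) \<in> (adj H)\<^sup>*")
    case True
    then show ?thesis
    proof induction
      case (step y z)
      then obtain f where f: "f \<in> edges H" "ends H f = {y, z}"
        by (auto simp: adj_def)
      have yz: "y \<in> verts H" "z \<in> verts H"
        using finite_multigraph_ends_subset[OF H f(1)] f(2) by auto
      have "card (sink_orientations H {y}) = card (sink_orientations H {z})" if "y \<noteq> z"
      proof -
        have "card (edges (delete_edge H f)) < card (edges H)"
          using card_Diff1_less[OF finite_multigraph.finite_edges[OF H] f(1)] by simp
        then have "card (sink_orientations (delete_edge H f) {y}) =
            card (sink_orientations (delete_edge H f) {z})"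
          by (rule less.hyps[OF _ finite_multigraph_delete_edge[OF H]]) (use yz in simp_all)
        moreover have "ends H f = {z, y}" using f(2) by auto
        ultimately show ?thesis
          using card_sink_orientations_delete_edge[OF H f that]
            card_sink_orientations_delete_edge[OF H f(1) \<open>ends H f = {z, y}\<close>] that
          by (simp add: insert_commute)
      qed
      then show ?case using step.IH by (cases "y = z") auto
    qed simp
  next
    case False
    then have "(v, u) \<notin> (adj H)\<^sup>*" using adj_rtrancl_sym by metis
    then have "sink_orientations H {u} = {}" "sink_orientations H {v} = {}"
      using unique_sink_reachable[OF H] less.prems(2,3) False by blast+
    then show ?thesis by simp
  qed
qed

section \<open>Identifying the sinks of an orientation\<close>

lemma trancl_map_prod_image:
  assumes "(a, b) \<in> r\<^sup>+"
  shows "(\<phi> a, \<phi> b) \<in> (map_prod \<phi> \<phi> ` r)\<^sup>+"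
  using assms
proof induction
  case (base y)
  then show ?case by (auto intro!: r_into_trancl image_eqI)
next
  case (step y z)
  have "(\<phi> y, \<phi> z) \<in> map_prod \<phi> \<phi> ` r" using step.hyps(2) by force
  with step.IH show ?case by (rule trancl_into_trancl)
qed

lemma acyclic_map_prod_imageD:
  assumes "acyclic (map_prod \<phi> \<phi> ` r)"
  shows "acyclic r"
  using assms trancl_map_prod_image unfolding acyclic_def by metis

text \<open>Only points of \<open>S\<close> can share an image, and no arc starts in
  \<open>S\<close>. So where two arcs of the image follow each other, the tail of the second has a
  unique preimage, and paths lift to \<open>r\<close> arc by arc.\<close>

lemma acyclic_map_prod_image:
  assumes r: "acyclic r" and V: "fst ` r \<subseteq> V" "snd ` r \<subseteq> V" and S: "fst ` r \<inter> S = {}"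
    and \<phi>: "\<And>a b. a \<in> V \<Longrightarrow> b \<in> V \<Longrightarrow> \<phi> a = \<phi> b \<Longrightarrow> a \<notin> S \<Longrightarrow> a = b"
  shows "acyclic (map_prod \<phi> \<phi> ` r)"
proof -
  \<comment> \<open>Recording \<open>a \<in> V - S\<close> is what later turns a closed path of the
    image into a closed path of \<open>r\<close>.\<close>
  have path: "\<exists>a b. p = \<phi> a \<and> p' = \<phi> b \<and> a \<in> V - S \<and> b \<in> V \<and> (a, b) \<in> r\<^sup>+"
    if "(p, p') \<in> (map_prod \<phi> \<phi> ` r)\<^sup>+" for p p'
    using that
  proof induction
    case (base y)
    then obtain a b where "(a, b) \<in> r" "p = \<phi> a" "y = \<phi> b" by auto
    moreover from this have "a \<in> V - S" "b \<in> V" using V S by force+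
    ultimately show ?case by blast
  next
    case (step y z)
    then obtain a b where ab: "p = \<phi> a" "y = \<phi> b" "a \<in> V - S" "b \<in> V" "(a, b) \<in> r\<^sup>+"
      by blast
    from step.hyps(2) obtain b' c where bc: "(b', c) \<in> r" "y = \<phi> b'" "z = \<phi> c" by auto
    then have "b' \<in> V - S" "c \<in> V" using V S by force+
    then have "b' = b" using \<phi>[of b' b] ab bc by auto
    then have "(a, c) \<in> r\<^sup>+" using ab(5) bc(1) by simp
    then show ?case using ab bc \<open>c \<in> V\<close> by blast
  qed
  show ?thesis
    unfolding acyclic_def
  proof (intro allI notI)
    fix p assume "(p, p) \<in> (map_prod \<phi> \<phi> ` r)\<^sup>+"
    then obtain a b where "p = \<phi> a" "p = \<phi> b" "a \<in> V - S" "b \<in> V" "(a, b) \<in> r\<^sup>+"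
      using path by blast
    then have "(a, a) \<in> r\<^sup>+" using \<phi>[of a b] by auto
    then show False using r by (auto simp: acyclic_def)
  qed
qed

text \<open>Sinks emit no arcs, so identifying them creates no cycle, and the tail of each arc,
  lying outside \<open>S\<close>, is still determined by its image. With two elements in
  \<open>S\<close> this merges two sinks into one; with a singleton it renames vertices.\<close>

lemma card_sink_orientations_collapse:
  fixes H :: "('a, 'e) multigraph" and H' :: "('b, 'e) multigraph"
  assumes H: "finite_multigraph H"
    and edges: "edges H' = edges H" and verts: "verts H' = \<phi> ` verts H"
    and ends: "\<And>f. f \<in> edges H \<Longrightarrow> ends H' f = \<phi> ` ends H f"
    and S: "S \<subseteq> verts H" "\<phi> ` S = {q}"
    and sep: "\<And>v. v \<in> verts H \<Longrightarrow> \<phi> v = q \<Longrightarrow> v \<in> S"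
    and inj: "inj_on \<phi> (verts H - S)"
  shows "card (sink_orientations H S) = card (sink_orientations H' {q})"
proof -
  let ?F = "\<lambda>d. \<lambda>f\<in>edges H. map_prod \<phi> \<phi> (d f)"
  \<comment> \<open>\<open>S\<close> is the whole fibre over \<open>q\<close>, so a vertex outside
    \<open>S\<close> never shares its image with one in \<open>S\<close>.\<close>
  have collapse: "a = b" if "a \<in> verts H" "b \<in> verts H" "\<phi> a = \<phi> b" "a \<notin> S" for a b
  proof -
    have "b \<notin> S" using sep[OF that(1)] S(2) that(3,4) by blast
    then show ?thesis using inj_onD[OF inj that(3)] that by blast
  qed
  have ext: "d f = undefined" if "d \<in> orientations K" "f \<notin> edges K"
    for K :: "('c, 'e) multigraph" and d f
    using that by (auto simp: orientations_def)
  have endsD: "fst (d f) \<in> verts H" "snd (d f) \<in> verts H"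
    if "d \<in> orientations H" "f \<in> edges H" for d f
    using orientation_ends[OF that] finite_multigraph_ends_subset[OF H that(2)] by auto
  have "bij_betw ?F (sink_orientations H S) (sink_orientations H' {q})"
    unfolding bij_betw_def
  proof
    show "inj_on ?F (sink_orientations H S)"
    proof (rule inj_onI)
      fix d d' assume d: "d \<in> sink_orientations H S" and d': "d' \<in> sink_orientations H S"
        and eq: "?F d = ?F d'"
      show "d = d'"
      proof
        fix f show "d f = d' f"
        proof (cases "f \<in> edges H")
          case True
          note D = sink_orientationsD(1)[OF d] and D' = sink_orientationsD(1)[OF d']
          have "map_prod \<phi> \<phi> (d f) = map_prod \<phi> \<phi> (d' f)"
            using fun_cong[OF eq, of f] True by simp
          \<comment> \<open>The tail is recovered from its image because it avoids \<open>S\<close>;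
            the head is then the other end of \<open>f\<close>.\<close>
          then have "\<phi> (fst (d f)) = \<phi> (fst (d' f))"
            by (metis fst_map_prod)
          then have "fst (d f) = fst (d' f)"
            by (rule collapse[OF endsD(1)[OF D True] endsD(1)[OF D' True] _ not_fst_sink[OF d True]])
          moreover have "{fst (d f), snd (d f)} = {fst (d' f), snd (d' f)}"
            using orientation_ends[OF D True] orientation_ends[OF D' True] by simp
          ultimately show ?thesis by (auto simp: doubleton_eq_iff prod_eq_iff)
        next
          case False
          then show ?thesis using ext sink_orientationsD(1) d d' by metis
        qed
      qed
    qed
    show "?F ` sink_orientations H S = sink_orientations H' {q}"
    proof (intro equalityI subsetI)
      fix d' assume "d' \<in> ?F ` sink_orientations H S"
      then obtain d where d: "d \<in> sink_orientations H S" and d': "d' = ?F d" by blast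
      note D = sink_orientationsD[OF d]
      show "d' \<in> sink_orientations H' {q}"
      proof (rule sink_orientationsI)
        show "d' \<in> orientations H'"
        proof (rule orientationI)
          show "d' \<in> extensional (edges H')" by (simp add: d' edges)
          fix f assume "f \<in> edges H'"
          then have f: "f \<in> edges H" by (simp add: edges)
          show "ends H' f = {fst (d' f), snd (d' f)}"
            using ends[OF f] orientation_ends[OF D(1) f] f by (simp add: d')
        qed
        have "d' ` edges H' = map_prod \<phi> \<phi> ` (d ` edges H)"
          by (simp add: image_image d' edges)
        moreover have "acyclic (map_prod \<phi> \<phi> ` (d ` edges H))"
        proof (rule acyclic_map_prod_image[where V = "verts H" and S = S])
          show "fst ` d ` edges H \<inter> S = {}" using not_fst_sink[OF d] by auto
        qed (use D(2) endsD[OF D(1)] collapse in auto)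
        ultimately show "acyclic (d' ` edges H')" by simp
        show "sinks H' d' = {q}"
        proof (intro equalityI subsetI)
          fix p assume "p \<in> sinks H' d'"
          then obtain v where v: "v \<in> verts H" "p = \<phi> v" and
            p: "\<And>f. f \<in> edges H \<Longrightarrow> fst (d' f) \<noteq> p"
            by (auto simp: sinks_def verts edges)
          have "v \<in> S"
          proof (rule ccontr)
            assume "v \<notin> S"
            then obtain f where "f \<in> edges H" "fst (d f) = v"
              using sink_orientation_nonsink[OF d v(1)] by auto
            then show False using p[of f] v(2) by (simp add: d')
          qed
          then show "p \<in> {q}" using S(2) v(2) by auto
        next
          fix p assume "p \<in> {q}"
          then have p: "p = q" by simp
          have "fst (d' f) \<noteq> q" if "f \<in> edges H" for f
            using sep[OF endsD(1)[OF D(1) that]] not_fst_sink[OF d that] that by (auto simp: d')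
          moreover have "q \<in> \<phi> ` verts H" using S by blast
          ultimately show "p \<in> sinks H' d'"
            by (simp add: p sinks_def edges verts)
        qed
      qed
    next
      fix d' assume d': "d' \<in> sink_orientations H' {q}"
      note D' = sink_orientationsD[OF d']
      \<comment> \<open>The lift is chosen edge by edge: one of the two orders of the ends of
        \<open>f\<close> maps to \<open>d' f\<close>.\<close>
      have "\<exists>p. ends H f = {fst p, snd p} \<and> map_prod \<phi> \<phi> p = d' f" if f: "f \<in> edges H" for f
      proof -
        obtain a b where ab: "ends H f = {a, b}"
          using finite_multigraph.ends_wf[OF H f] by blast
        then have "{\<phi> a, \<phi> b} = {fst (d' f), snd (d' f)}"
          using ends[OF f] orientation_ends[OF D'(1), of f] f by (simp add: edges)
        then consider "map_prod \<phi> \<phi> (a, b) = d' f" | "map_prod \<phi> \<phi> (b, a) = d' f"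
          by (auto simp: doubleton_eq_iff prod_eq_iff)
        then show ?thesis
        proof cases
          case 1
          then show ?thesis using ab by (intro exI[of _ "(a, b)"]) simp
        next
          case 2
          then show ?thesis using ab by (intro exI[of _ "(b, a)"]) auto
        qed
      qed
      then obtain c where c: "\<And>f. f \<in> edges H \<Longrightarrow> ends H f = {fst (c f), snd (c f)}"
        "\<And>f. f \<in> edges H \<Longrightarrow> map_prod \<phi> \<phi> (c f) = d' f"
        by metis
      define d where "d = restrict c (edges H)"
      have dor: "d \<in> orientations H"
        by (rule orientationI) (use c(1) in \<open>auto simp: d_def\<close>)
      have Fd: "?F d = d'"
      proof
        fix f show "?F d f = d' f"
          using c(2)[of f] ext[OF D'(1), of f] by (simp add: d_def edges)
      qed
      have "d \<in> sink_orientations H S"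
      proof (rule sink_orientationsI[OF dor])
        have "d' ` edges H' = map_prod \<phi> \<phi> ` (d ` edges H)"
          by (simp add: edges image_image d_def c(2))
        then show "acyclic (d ` edges H)"
          using D'(2) acyclic_map_prod_imageD by metis
        show "sinks H d = S"
        proof (intro equalityI subsetI)
          fix v assume v: "v \<in> sinks H d"
          show "v \<in> S"
          proof (rule ccontr)
            assume "v \<notin> S"
            \<comment> \<open>An arc leaves the non-sink \<open>\<phi> v\<close>; the tail of its
              lift has the same image as \<open>v\<close>, hence is \<open>v\<close> itself.\<close>
            then have "\<phi> v \<in> verts H'" "\<phi> v \<noteq> q"
              using v sep verts by (auto simp: sinks_def)
            then obtain f where f: "f \<in> edges H'" "fst (d' f) = \<phi> v"
              using sink_orientation_nonsink[OF d', of "\<phi> v"] by auto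
            then have f': "f \<in> edges H" by (simp add: edges)
            have "\<phi> v = \<phi> (fst (d f))"
              using f c(2)[OF f'] f' by (metis d_def fst_map_prod restrict_apply')
            then have "fst (d f) = v"
              using collapse[of v "fst (d f)"] v endsD(1)[OF dor f'] \<open>v \<notin> S\<close>
              by (auto simp: sinks_def)
            then show False using v f' by (auto simp: sinks_def)
          qed
        next
          fix v assume v: "v \<in> S"
          have "fst (d f) \<noteq> v" if f: "f \<in> edges H" for f
          proof
            assume "fst (d f) = v"
            then have "fst (d' f) = q"
              using c(2)[OF f] f S(2) v by (metis d_def fst_map_prod image_eqI restrict_apply' singletonD)
            then show False using not_fst_sink[OF d'] f edges by auto
          qed
          then show "v \<in> sinks H d" using v S(1) by (auto simp: sinks_def)
        qed
      qed
      then show "d' \<in> ?F ` sink_orientations H S" using Fd by (intro image_eqI) auto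
    qed
  qed
  then show ?thesis by (rule bij_betw_same_card)
qed

section \<open>Alternating numbers as signed sums over connected partitions\<close>

lemma partition_on_eq:
  assumes "partition_on V P" "W \<in> P" "W' \<in> P" "v \<in> W" "v \<in> W'"
  shows "W = W'"
  using assms by (auto simp: partition_on_def disjoint_def)

lemma partition_on_finite_card_le:
  assumes "finite V" "partition_on V P"
  shows "finite P" "card P \<le> card V"
proof -
  show P: "finite P" using assms by (rule finite_elements)
  have "\<forall>W\<in>P. \<exists>v. v \<in> W"
    using partition_onD3[OF assms(2)] by (metis all_not_in_conv)
  then obtain h where h: "\<And>W. W \<in> P \<Longrightarrow> h W \<in> W" by metis
  have "inj_on h P"
    by (rule inj_onI) (metis h partition_on_eq[OF assms(2)])
  moreover have "h ` P \<subseteq> V"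
    using h partition_onD1[OF assms(2)] by auto
  ultimately show "card P \<le> card V"
    using assms(1) by (rule card_inj_on_le)
qed

text \<open>A union instead of a choice operator: in a partition of a set containing
  \<open>v\<close> the family has exactly one member, so the union is that part.\<close>

definition part :: "'a set set \<Rightarrow> 'a \<Rightarrow> 'a set" where
  "part P v = \<Union> {W \<in> P. v \<in> W}"

lemma part_eq:
  assumes "partition_on V P" "W \<in> P" "v \<in> W"
  shows "part P v = W"
proof -
  have "{W' \<in> P. v \<in> W'} = {W}"
    using partition_on_eq[OF assms(1)] assms(2,3) by auto
  then show ?thesis by (simp add: part_def)
qed

lemma part_in:
  assumes "partition_on V P" "v \<in> V"
  shows "part P v \<in> P" "v \<in> part P v"
proof -
  obtain W where "W \<in> P" "v \<in> W"
    using partition_onD1[OF assms(1)] assms(2) by auto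
  then show "part P v \<in> P" "v \<in> part P v"
    using part_eq[OF assms(1)] by simp_all
qed

text \<open>The second index of \<open>beta\<close> counts these edges: with \<open>m - j\<close>
  edges between parts out of \<open>m + l\<close> edges in total, where \<open>l\<close> is the
  number of loops, \<open>j + l = k\<close> of them lie inside parts.\<close>

definition inner_edges :: "('v, 'e) multigraph \<Rightarrow> 'v set set \<Rightarrow> 'e set" where
  "inner_edges G P = {f \<in> edges G. \<exists>W \<in> P. ends G f \<subseteq> W}"

definition connected_partitions :: "('v, 'e) multigraph \<Rightarrow> int \<Rightarrow> 'v set set set" where
  "connected_partitions G k =
    {P. connected_partition G P \<and> int (card (inner_edges G P)) = k}"

lemma partition_graph_simps [simp]:
  "verts (partition_graph G P) = P"
  "edges (partition_graph G P) = edges G - inner_edges G P"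
  "ends (partition_graph G P) f = {W \<in> P. W \<inter> ends G f \<noteq> {}}"
  by (auto simp: partition_graph_def inner_edges_def)

lemma partition_graph_delete_edge:
  "partition_graph (delete_edge G e) P = delete_edge (partition_graph G P) e"
  by (auto simp: partition_graph_def delete_edge_def)

lemma finite_multigraph_partition_graph:
  assumes G: "finite_multigraph G" and P: "partition_on (verts G) P"
  shows "finite_multigraph (partition_graph G P)"
proof
  show "finite (verts (partition_graph G P))"
    using partition_on_finite_card_le(1)[OF finite_multigraph.finite_verts[OF G] P] by simp
  show "finite (edges (partition_graph G P))"
    using finite_multigraph.finite_edges[OF G] by simp
  fix f assume "f \<in> edges (partition_graph G P)"
  then have "f \<in> edges G" by simp
  then obtain u w where uw: "u \<in> verts G" "w \<in> verts G" "ends G f = {u, w}"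
    using finite_multigraph.ends_wf[OF G] by blast
  have ends: "ends (partition_graph G P) f = {part P u, part P w}"
  proof (intro equalityI subsetI)
    fix W assume "W \<in> ends (partition_graph G P) f"
    then have "W \<in> P" "u \<in> W \<or> w \<in> W" by (auto simp: uw(3))
    then show "W \<in> {part P u, part P w}" using part_eq[OF P] by blast
  next
    fix W assume "W \<in> {part P u, part P w}"
    then show "W \<in> ends (partition_graph G P) f"
      using part_in[OF P uw(1)] part_in[OF P uw(2)] by (auto simp: uw(3))
  qed
  show "\<exists>u\<in>verts (partition_graph G P). \<exists>w\<in>verts (partition_graph G P).
      ends (partition_graph G P) f = {u, w}"
    by (intro bexI, rule ends) (simp_all add: part_in(1)[OF P] uw(1,2))
qed

lemma card_edges_eq_loops_plus_non_loops:
  assumes "finite_multigraph G"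
  shows "card (edges G) = card (loops G) + card (non_loops G)"
proof -
  have "edges G = loops G \<union> non_loops G"
  proof -
    have "card (ends G f) = 1 \<or> card (ends G f) = 2" if "f \<in> edges G" for f
    proof -
      obtain u w where "ends G f = {u, w}"
        using finite_multigraph.ends_wf[OF assms \<open>f \<in> edges G\<close>] by blast
      then show ?thesis by (cases "u = w") auto
    qed
    then show ?thesis by (auto simp: loops_def non_loops_def)
  qed
  moreover have "loops G \<inter> non_loops G = {}"
    by (auto simp: loops_def non_loops_def)
  moreover have "finite (loops G)" "finite (non_loops G)"
    using finite_multigraph.finite_edges[OF assms] by (auto simp: loops_def non_loops_def)
  ultimately show ?thesis by (simp add: card_Un_disjoint)
qed

lemma finite_connected_partitions:
  assumes "finite_multigraph G"
  shows "finite (connected_partitions G k)"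
  using finitely_many_partition_on[OF finite_multigraph.finite_verts[OF assms]]
  by (rule rev_finite_subset) (auto simp: connected_partitions_def connected_partition_def)

lemma connected_partitionsD:
  assumes "P \<in> connected_partitions G k"
  shows "partition_on (verts G) P" "connected_partition G P"
    "int (card (inner_edges G P)) = k"
  using assms by (auto simp: connected_partitions_def connected_partition_def)

text \<open>The pairs \<open>(P, d)\<close> are counted fibre by fibre over \<open>P\<close>. Loops
  and non-loops together make up all edges, which turns the condition on edges between parts into
  one on inner edges.\<close>

lemma beta_eq_sum:
  assumes G: "finite_multigraph G" and q: "q \<in> verts G" and i: "i \<le> card (verts G)"
  shows "beta G q i k = (\<Sum>P \<in> {P \<in> connected_partitions G k. card (verts G) - card P = i}.
    card (sink_orientations (partition_graph G P) {part P q}))"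
proof -
  let ?C = "{P \<in> connected_partitions G k. card (verts G) - card P = i}"
  let ?R = "\<lambda>P. sink_orientations (partition_graph G P) {part P q}"
  \<comment> \<open>The natural-number difference is exact because
    \<open>card P \<le> card (verts G)\<close>.\<close>
  have cond: "int (card P) = int (card (verts G)) - int i \<and>
      int (card (edges (partition_graph G P))) =
        int (card (non_loops G)) - (k - int (card (loops G))) \<longleftrightarrow>
      card (verts G) - card P = i \<and> int (card (inner_edges G P)) = k"
    if P: "connected_partition G P" for P
  proof -
    have "card P \<le> card (verts G)"
      using P partition_on_finite_card_le(2)[OF finite_multigraph.finite_verts[OF G]]
      by (simp add: connected_partition_def)
    moreover have "inner_edges G P \<subseteq> edges G" by (auto simp: inner_edges_def)
    then have "card (edges G - inner_edges G P) + card (inner_edges G P) = card (edges G)"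
      using finite_multigraph.finite_edges[OF G]
      by (metis card_Diff_subset card_mono finite_subset le_add_diff_inverse2)
    ultimately show ?thesis
      using card_edges_eq_loops_plus_non_loops[OF G] i by (simp del: of_nat_diff) arith
  qed
  \<comment> \<open>The only sink contains \<open>q\<close>, and a part containing \<open>q\<close>
    is \<open>part P q\<close>.\<close>
  have root: "d \<in> acyclic_orientations (partition_graph G P) \<and>
      (\<exists>W. q \<in> W \<and> sinks (partition_graph G P) d = {W}) \<longleftrightarrow> d \<in> ?R P"
    if "connected_partition G P" for P d
  proof -
    have P: "partition_on (verts G) P" using that by (simp add: connected_partition_def)
    have "W = part P q" if "q \<in> W" "sinks (partition_graph G P) d = {W}" for W
    proof -
      have "W \<in> P" using that(2) by (auto simp: sinks_def)
      then show ?thesis using part_eq[OF P _ that(1)] by simp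
    qed
    then show ?thesis
      using part_in(2)[OF P q] by (auto simp: sink_orientations_def)
  qed
  have "beta G q i k = card (SIGMA P:?C. ?R P)"
    unfolding beta_def
  proof (rule arg_cong[where f = card], rule set_eqI, clarify)
    fix P d
    show "(P, d) \<in> {(P, d). connected_partition G P \<and>
        int (card P) = int (card (verts G)) - int i \<and>
        int (card (edges (partition_graph G P))) =
          int (card (non_loops G)) - (k - int (card (loops G))) \<and>
        d \<in> acyclic_orientations (partition_graph G P) \<and>
        (\<exists>W. q \<in> W \<and> sinks (partition_graph G P) d = {W})} \<longleftrightarrow>
      (P, d) \<in> (SIGMA P:?C. ?R P)"
      using cond[of P] root[of P d] unfolding connected_partitions_def by blast
  qed
  also have "\<dots> = (\<Sum>P\<in>?C. card (?R P))"
  proof (rule card_SigmaI)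
    show "finite ?C" using finite_connected_partitions[OF G] by simp
    show "\<forall>P\<in>?C. finite (?R P)"
      using finite_sink_orientations finite_multigraph_partition_graph[OF G]
        connected_partitionsD(1) by blast
  qed
  finally show ?thesis .
qed

text \<open>The exponent has the parity of \<open>i = card (verts G) - card P\<close> and avoids
  truncated subtraction.\<close>

definition signed_term :: "('v, 'e) multigraph \<Rightarrow> 'v \<Rightarrow> 'v set set \<Rightarrow> int" where
  "signed_term G q P = (-1) ^ (card (verts G) + card P) *
    int (card (sink_orientations (partition_graph G P) {part P q}))"

lemma alternating_number_eq_sum:
  assumes G: "finite_multigraph G" and q: "q \<in> verts G"
  shows "alternating_number G q k = (\<Sum>P\<in>connected_partitions G k. signed_term G q P)"
proof -
  let ?C = "\<lambda>i. {P \<in> connected_partitions G k. card (verts G) - card P = i}"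
  have "(-1) ^ i * int (beta G q i k) = sum (signed_term G q) (?C i)"
    if "i \<in> {0..card (verts G)}" for i
  proof -
    have "(-1) ^ i * int (card (sink_orientations (partition_graph G P) {part P q})) =
        signed_term G q P" if "P \<in> ?C i" for P
    proof -
      have "card P \<le> card (verts G)"
        using that partition_on_finite_card_le(2)[OF finite_multigraph.finite_verts[OF G]]
          connected_partitionsD(1) by blast
      then have "card (verts G) + card P = i + 2 * card P" using that by auto
      then show ?thesis by (simp add: signed_term_def power_add power_mult)
    qed
    then show ?thesis
      using beta_eq_sum[OF G q] that by (simp add: sum_distrib_left)
  qed
  then have "alternating_number G q k = (\<Sum>i\<in>{0..card (verts G)}. sum (signed_term G q) (?C i))"
    unfolding alternating_number_def by (rule sum.cong[OF refl])
  \<comment> \<open>Each partition has its difference in the range of \<open>i\<close>, so the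
    classes \<open>?C i\<close> cover all connected partitions.\<close>
  also have "\<dots> = sum (signed_term G q) (connected_partitions G k)"
    by (rule sum.group) (auto simp: finite_connected_partitions[OF G])
  finally show ?thesis .
qed

lemma signed_term_root_independent:
  assumes "finite_multigraph G" "partition_on (verts G) P" "q \<in> verts G" "q' \<in> verts G"
  shows "signed_term G q P = signed_term G q' P"
  unfolding signed_term_def
  using card_unique_sink_root_independent[OF finite_multigraph_partition_graph[OF assms(1,2)],
      of "part P q" "part P q'"] part_in(1)[OF assms(2)] assms(3,4) by simp

lemma alternating_number_root_independent:
  assumes "finite_multigraph G" "q \<in> verts G" "q' \<in> verts G"
  shows "alternating_number G q k = alternating_number G q' k"
  unfolding alternating_number_eq_sum[OF assms(1,2)] alternating_number_eq_sum[OF assms(1,3)]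
  by (intro sum.cong refl signed_term_root_independent[OF assms(1) connected_partitionsD(1) assms(2,3)])

section \<open>Connected partitions under contraction and deletion\<close>

lemma induced_simps [simp]:
  "verts (induced G W) = W"
  "edges (induced G W) = {f \<in> edges G. ends G f \<subseteq> W}"
  "ends (induced G W) = ends G"
  by (simp_all add: induced_def)

lemma partition_on_merge:
  assumes "partition_on V P" "W1 \<in> P" "W2 \<in> P"
  shows "partition_on V (insert (W1 \<union> W2) (P - {W1, W2}))"
proof (rule partition_onI)
  show "\<Union> (insert (W1 \<union> W2) (P - {W1, W2})) = V"
    using partition_onD1[OF assms(1)] assms(2,3) by blast
  show "{} \<notin> insert (W1 \<union> W2) (P - {W1, W2})"
    using partition_onD3[OF assms(1)] assms(2) by auto
  fix p q assume "p \<in> insert (W1 \<union> W2) (P - {W1, W2})" "q \<in> insert (W1 \<union> W2) (P - {W1, W2})" "p \<noteq> q"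
  then show "disjnt p q"
    using partition_on_eq[OF assms(1)] assms(2,3) unfolding disjnt_iff by blast
qed

lemma partition_on_split:
  assumes "partition_on V P" "K1 \<union> K2 \<in> P" "K1 \<inter> K2 = {}" "K1 \<noteq> {}" "K2 \<noteq> {}"
  shows "partition_on V (P - {K1 \<union> K2} \<union> {K1, K2})"
proof (rule partition_onI)
  show "\<Union> (P - {K1 \<union> K2} \<union> {K1, K2}) = V"
    using partition_onD1[OF assms(1)] assms(2) by blast
  show "{} \<notin> P - {K1 \<union> K2} \<union> {K1, K2}"
    using partition_onD3[OF assms(1)] assms(4,5) by auto
  fix p q assume "p \<in> P - {K1 \<union> K2} \<union> {K1, K2}" "q \<in> P - {K1 \<union> K2} \<union> {K1, K2}" "p \<noteq> q"
  moreover have "w \<notin> K1 \<union> K2" if "w \<in> p" "p \<in> P - {K1 \<union> K2}" for w p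
    using partition_on_eq[OF assms(1,2), of p w] that by auto
  ultimately show "disjnt p q"
    using partition_on_eq[OF assms(1)] assms(3) unfolding disjnt_iff by blast
qed

definition merge_parts :: "'a \<Rightarrow> 'a \<Rightarrow> 'a set set \<Rightarrow> 'a set set" where
  "merge_parts v w P = insert (part P v \<union> part P w) (P - {part P v, part P w})"

lemma adj_induced_mono:
  assumes "W \<subseteq> W'"
  shows "(adj (induced H W))\<^sup>* \<subseteq> (adj (induced H W'))\<^sup>*"
  by (rule rtrancl_mono) (use assms in \<open>auto simp: adj_def\<close>)

lemma adj_induced_delete_edge_subset:
  "(adj (induced (delete_edge H e) W))\<^sup>* \<subseteq> (adj (induced H W))\<^sup>*"
  by (rule rtrancl_mono) (auto simp: adj_def)

lemma induced_delete_edge: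
  assumes "\<not> ends H e \<subseteq> W"
  shows "induced (delete_edge H e) W = induced H W"
  using assms by (auto simp: induced_def)

lemma inner_edges_delete_edge: "inner_edges (delete_edge H e) P = inner_edges H P - {e}"
  by (auto simp: inner_edges_def)

lemma connected_partition_delete_edgeD:
  assumes "connected_partition (delete_edge H e) P"
  shows "connected_partition H P"
  unfolding connected_partition_def connected_mg_def
proof (intro conjI ballI)
  show "partition_on (verts H) P"
    using assms by (simp add: connected_partition_def)
  fix W assume "W \<in> P"
  then have W: "connected_mg (induced (delete_edge H e) W)"
    using assms by (simp add: connected_partition_def)
  then show "verts (induced H W) \<noteq> {}" by (simp add: connected_mg_def)
  fix u w assume "u \<in> verts (induced H W)" "w \<in> verts (induced H W)"
  then have "(u, w) \<in> (adj (induced (delete_edge H e) W))\<^sup>*"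
    using W by (simp add: connected_mg_def)
  then show "(u, w) \<in> (adj (induced H W))\<^sup>*"
    by (rule subsetD[OF adj_induced_delete_edge_subset])
qed

lemma connected_partition_delete_edge_iff:
  assumes "e \<in> edges H" "e \<notin> inner_edges H P"
  shows "connected_partition (delete_edge H e) P \<longleftrightarrow> connected_partition H P"
proof -
  have "\<not> ends H e \<subseteq> W" if "W \<in> P" for W
    using assms that by (auto simp: inner_edges_def)
  then show ?thesis
    by (simp add: connected_partition_def induced_delete_edge)
qed

text \<open>For \<open>v\<close> in \<open>W\<close>, the connected component of \<open>v\<close> in
  the subgraph induced on \<open>W\<close> with \<open>e\<close> removed. Taken at both ends of
  \<open>e\<close>, it gives the pieces into which a part splits.\<close>

definition component_without ::
  "('v, 'e) multigraph \<Rightarrow> 'e \<Rightarrow> 'v set \<Rightarrow> 'v \<Rightarrow> 'v set" where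
  "component_without H e W v = {w \<in> W. (v, w) \<in> (adj (induced (delete_edge H e) W))\<^sup>*}"

text \<open>A path from \<open>v\<close> that avoids \<open>e\<close> runs through vertices
  reachable from \<open>v\<close> only, so it survives the restriction to the component.\<close>

lemma connected_induced_component:
  assumes "v \<in> W"
  shows "connected_mg (induced H (component_without H e W v))"
proof -
  let ?K = "component_without H e W v"
  have reach: "(v, w) \<in> (adj (induced H ?K))\<^sup>*"
    if "(v, w) \<in> (adj (induced (delete_edge H e) W))\<^sup>*" for w
    using that
  proof induction
    case (step y z)
    then obtain f where f: "f \<in> edges H" "ends H f = {y, z}" "{y, z} \<subseteq> W"
      by (auto simp: adj_def)
    have "(v, z) \<in> (adj (induced (delete_edge H e) W))\<^sup>*"
      using step.hyps by (rule rtrancl_into_rtrancl)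
    then have "{y, z} \<subseteq> ?K"
      using f(3) step.hyps(1) by (auto simp: component_without_def)
    then have "(y, z) \<in> adj (induced H ?K)"
      using f by (auto simp: adj_def)
    with step.IH show ?case by (rule rtrancl_into_rtrancl)
  qed simp
  have "(u, w) \<in> (adj (induced H ?K))\<^sup>*" if "u \<in> ?K" "w \<in> ?K" for u w
  proof -
    have "(v, u) \<in> (adj (induced H ?K))\<^sup>*" "(v, w) \<in> (adj (induced H ?K))\<^sup>*"
      using reach that by (auto simp: component_without_def)
    then show ?thesis using adj_rtrancl_sym by (meson rtrancl_trans)
  qed
  moreover have "v \<in> ?K" using assms by (simp add: component_without_def)
  ultimately show ?thesis by (auto simp: connected_mg_def)
qed

section \<open>Splitting and merging parts along an edge\<close>

locale multigraph_edge = finite_multigraph G for G :: "('v, 'e) multigraph" +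
  fixes e :: 'e and v1 v2 :: 'v
  assumes edge: "e \<in> edges G" and ends_edge: "ends G e = {v1, v2}" and distinct: "v1 \<noteq> v2"
begin

lemma ends_in_verts: "v1 \<in> verts G" "v2 \<in> verts G"
  using finite_multigraph_ends_subset[OF finite_multigraph_axioms edge] ends_edge by auto

lemma edge_inner_iff: "e \<in> inner_edges G P \<longleftrightarrow> (\<exists>W\<in>P. v1 \<in> W \<and> v2 \<in> W)"
  using edge by (auto simp: inner_edges_def ends_edge)

lemma inner_part_both:
  assumes "partition_on (verts G) P" "e \<in> inner_edges G P" "W \<in> P"
  shows "v1 \<in> W \<longleftrightarrow> v2 \<in> W"
  using assms partition_on_eq[OF assms(1)] by (metis edge_inner_iff)

lemma not_inner_parts:
  assumes P: "partition_on (verts G) P" and "e \<notin> inner_edges G P"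
  shows "part P v1 \<noteq> part P v2"
  using part_in[OF P ends_in_verts(1)] part_in[OF P ends_in_verts(2)] assms(2)
  by (metis edge_inner_iff)

text \<open>The last condition says that \<open>e\<close> is the only edge between the parts of its end points.\<close>

definition "separating = {P. connected_partition G P \<and> e \<notin> inner_edges G P \<and>
  inner_edges G (merge_parts v1 v2 P) = insert e (inner_edges G P)}"

text \<open>These are the partitions in which \<open>e\<close> is a bridge of the part containing
  it.\<close>

definition "disconnecting = {P. connected_partition G P \<and> e \<in> inner_edges G P \<and>
  \<not> connected_partition (delete_edge G e) P}"

text \<open>\<open>e\<close> lies in neither part, so each stays connected without it; it is the
  only edge between them, so nothing else leads out. The two parts can thus be recovered from their
  union.\<close>

lemma component_eq_part:
  assumes P: "P \<in> separating" and v: "v \<in> {v1, v2}"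
  shows "component_without G e (part P v1 \<union> part P v2) v = part P v"
proof -
  let ?W = "part P v1 \<union> part P v2"
  have part: "partition_on (verts G) P" and conn: "\<And>W. W \<in> P \<Longrightarrow> connected_mg (induced G W)"
    and e: "e \<notin> inner_edges G P"
    and inner: "inner_edges G (merge_parts v1 v2 P) = insert e (inner_edges G P)"
    using P by (auto simp: separating_def connected_partition_def)
  have vG: "v \<in> verts G" using v ends_in_verts by auto
  note pv = part_in[OF part vG]
  have sub: "part P v \<subseteq> ?W" using v by auto
  show ?thesis
  proof (intro equalityI subsetI)
    fix w assume "w \<in> component_without G e ?W v"
    then have "(v, w) \<in> (adj (induced (delete_edge G e) ?W))\<^sup>*"
      by (simp add: component_without_def)
    then show "w \<in> part P v"
    proof induction
      case base
      show ?case by (rule pv(2))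
    next
      case (step y z)
      then obtain f where f: "f \<in> edges G" "f \<noteq> e" "ends G f = {y, z}" "{y, z} \<subseteq> ?W"
        by (auto simp: adj_def)
      \<comment> \<open>Inside the merged part every edge other than \<open>e\<close> was inner
        already, so the path cannot change parts.\<close>
      then have "f \<in> inner_edges G (merge_parts v1 v2 P)"
        by (auto simp: inner_edges_def merge_parts_def)
      then have "f \<in> inner_edges G P" using inner f(2) by auto
      then obtain W where "W \<in> P" "y \<in> W" "z \<in> W"
        using f(3) by (auto simp: inner_edges_def)
      then show ?case
        using partition_on_eq[OF part _ pv(1) _ step.IH] by blast
    qed
  next
    fix w assume w: "w \<in> part P v"
    have "\<not> ends G e \<subseteq> part P v"
      using e pv(1) edge by (auto simp: inner_edges_def)
    then have "(v, w) \<in> (adj (induced (delete_edge G e) (part P v)))\<^sup>*"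
      using conn[OF pv(1)] pv(2) w by (simp add: induced_delete_edge connected_mg_def)
    then have "(v, w) \<in> (adj (induced (delete_edge G e) ?W))\<^sup>*"
      using adj_induced_mono[OF sub] by blast
    then show "w \<in> component_without G e ?W v"
      using w sub by (auto simp: component_without_def)
  qed
qed

text \<open>That the union is not itself a part of \<open>P\<close> makes the merge reversible and
  lets the number of parts drop by exactly one.\<close>

lemma merge_parts_facts:
  assumes part: "partition_on (verts G) P" and e: "e \<notin> inner_edges G P"
  shows "partition_on (verts G) (merge_parts v1 v2 P)"
    and "part (merge_parts v1 v2 P) v1 = part P v1 \<union> part P v2"
    and "part P v1 \<union> part P v2 \<notin> P"
    and "card (merge_parts v1 v2 P) + 1 = card P"
proof -
  let ?W1 = "part P v1" and ?W2 = "part P v2"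
  note p1 = part_in[OF part ends_in_verts(1)] and p2 = part_in[OF part ends_in_verts(2)]
  have ne: "?W1 \<noteq> ?W2" by (rule not_inner_parts[OF part e])
  show M: "partition_on (verts G) (merge_parts v1 v2 P)"
    unfolding merge_parts_def by (rule partition_on_merge[OF part p1(1) p2(1)])
  show "part (merge_parts v1 v2 P) v1 = ?W1 \<union> ?W2"
    by (rule part_eq[OF M]) (use p1(2) in \<open>auto simp: merge_parts_def\<close>)
  show nin: "?W1 \<union> ?W2 \<notin> P"
  proof
    assume "?W1 \<union> ?W2 \<in> P"
    then have "?W1 \<union> ?W2 = ?W1" "?W1 \<union> ?W2 = ?W2"
      using part_eq[OF part] p1(2) p2(2) by (metis UnCI)+
    then show False using ne by simp
  qed
  have fin: "finite P" by (rule partition_on_finite_card_le(1)[OF finite_verts part])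
  have "card {?W1, ?W2} \<le> card P"
    by (rule card_mono[OF fin]) (use p1(1) p2(1) in auto)
  moreover have "card (P - {?W1, ?W2}) = card P - card {?W1, ?W2}"
    by (rule card_Diff_subset) (use p1(1) p2(1) in auto)
  ultimately show "card (merge_parts v1 v2 P) + 1 = card P"
    using fin nin ne by (simp add: merge_parts_def)
qed

text \<open>\<open>e\<close> connects the two connected parts; once it is removed, the component of
  \<open>v1\<close> in the union is \<open>part P v1\<close>, which misses
  \<open>v2\<close>.\<close>

lemma merge_parts_disconnecting:
  assumes P: "P \<in> separating"
  shows "merge_parts v1 v2 P \<in> disconnecting"
proof -
  let ?M = "merge_parts v1 v2 P" and ?W1 = "part P v1" and ?W2 = "part P v2"
  have part: "partition_on (verts G) P" and conn: "\<And>W. W \<in> P \<Longrightarrow> connected_mg (induced G W)"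
    and e: "e \<notin> inner_edges G P"
    using P by (auto simp: separating_def connected_partition_def)
  note p1 = part_in[OF part ends_in_verts(1)] and p2 = part_in[OF part ends_in_verts(2)]
  note M = merge_parts_facts[OF part e]
  have eM: "e \<in> inner_edges G ?M"
    using P by (auto simp: separating_def)
  have joined: "connected_mg (induced G (?W1 \<union> ?W2))"
  proof -
    let ?R = "(adj (induced G (?W1 \<union> ?W2)))\<^sup>*"
    have "(v1, v2) \<in> adj (induced G (?W1 \<union> ?W2))"
      using edge ends_edge p1(2) p2(2) by (auto simp: adj_def)
    then have v12: "(v1, v2) \<in> ?R" by blast
    have r1: "(v1, w) \<in> ?R" if "w \<in> ?W1" for w
    proof -
      have "(v1, w) \<in> (adj (induced G ?W1))\<^sup>*"
        using conn[OF p1(1)] p1(2) that by (simp add: connected_mg_def)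
      then show ?thesis by (rule subsetD[OF adj_induced_mono, rotated]) simp
    qed
    have r2: "(v1, w) \<in> ?R" if "w \<in> ?W2" for w
    proof -
      have "(v2, w) \<in> (adj (induced G ?W2))\<^sup>*"
        using conn[OF p2(1)] p2(2) that by (simp add: connected_mg_def)
      then have "(v2, w) \<in> ?R" by (rule subsetD[OF adj_induced_mono, rotated]) simp
      with v12 show ?thesis by (rule rtrancl_trans)
    qed
    have reach: "(v1, w) \<in> ?R" if "w \<in> ?W1 \<union> ?W2" for w
      using that r1 r2 by auto
    have "(u, w) \<in> ?R" if "u \<in> ?W1 \<union> ?W2" "w \<in> ?W1 \<union> ?W2" for u w
      using rtrancl_trans[OF adj_rtrancl_sym[OF reach[OF that(1)]] reach[OF that(2)]] .
    then show ?thesis using p1(2) by (auto simp: connected_mg_def)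
  qed
  have "connected_partition G ?M"
    using M(1) joined conn by (auto simp: connected_partition_def merge_parts_def)
  moreover have "\<not> connected_partition (delete_edge G e) ?M"
  proof
    assume "connected_partition (delete_edge G e) ?M"
    then have "connected_mg (induced (delete_edge G e) (?W1 \<union> ?W2))"
      by (simp add: connected_partition_def merge_parts_def)
    then have "v2 \<in> component_without G e (?W1 \<union> ?W2) v1"
      using p1(2) p2(2) by (simp add: component_without_def connected_mg_def)
    then have "v2 \<in> ?W1" using component_eq_part[OF P, of v1] by simp
    then have "?W1 = ?W2" using part_eq[OF part p1(1)] by simp
    then show False using not_inner_parts[OF part e] by simp
  qed
  ultimately show ?thesis using eM by (simp add: disconnecting_def)
qed

text \<open>The part \<open>W\<close> containing \<open>e\<close> is replaced by the components of
  \<open>v1\<close> and \<open>v2\<close> in \<open>W\<close> without \<open>e\<close>. They exhaust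
  \<open>W\<close>, and they are disjoint because otherwise \<open>W\<close> would stay
  connected.\<close>

lemma split_disconnecting:
  assumes P: "P \<in> disconnecting"
  obtains Q where "Q \<in> separating" "merge_parts v1 v2 Q = P"
proof -
  have part: "partition_on (verts G) P" and conn: "\<And>W. W \<in> P \<Longrightarrow> connected_mg (induced G W)"
    and e: "e \<in> inner_edges G P" and nconn: "\<not> connected_partition (delete_edge G e) P"
    using P by (auto simp: disconnecting_def connected_partition_def)
  define W where "W = part P v1"
  have W: "W \<in> P" "v1 \<in> W"
    using part_in[OF part ends_in_verts(1)] by (simp_all add: W_def)
  have v2W: "v2 \<in> W" using inner_part_both[OF part e W(1)] W(2) by simp
  let ?A = "adj (induced (delete_edge G e) W)"
  define K1 where "K1 = component_without G e W v1"
  define K2 where "K2 = component_without G e W v2"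
  have K: "v1 \<in> K1" "v2 \<in> K2"
    using W(2) v2W by (auto simp: K1_def K2_def component_without_def)
  \<comment> \<open>Each time a path from \<open>v1\<close> uses \<open>e\<close> it arrives at
    \<open>v1\<close> or \<open>v2\<close>; after the last such use it avoids
    \<open>e\<close>.\<close>
  have reach: "(v1, w) \<in> ?A\<^sup>* \<or> (v2, w) \<in> ?A\<^sup>*" if "w \<in> W" for w
  proof -
    have "(v1, w) \<in> (adj (induced G W))\<^sup>*"
      using conn[OF W(1)] W(2) that by (simp add: connected_mg_def)
    then show ?thesis
    proof induction
      case (step y z)
      then obtain f where f: "f \<in> edges G" "ends G f = {y, z}" "{y, z} \<subseteq> W"
        by (auto simp: adj_def)
      show ?case
      proof (cases "f = e")
        case True
        then have "z = v1 \<or> z = v2" using f(2) ends_edge by auto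
        then show ?thesis by auto
      next
        case False
        then have "(y, z) \<in> ?A" using f by (auto simp: adj_def)
        then show ?thesis using step.IH by (meson rtrancl_into_rtrancl)
      qed
    qed simp
  qed
  then have KW: "K1 \<union> K2 = W"
    by (auto simp: K1_def K2_def component_without_def)
  \<comment> \<open>Every other part misses \<open>e\<close> and stays connected, so the part that
    deletion disconnects is \<open>W\<close>.\<close>
  have "\<not> connected_mg (induced (delete_edge G e) W)"
  proof
    assume c: "connected_mg (induced (delete_edge G e) W)"
    have "connected_mg (induced (delete_edge G e) W')" if "W' \<in> P" for W'
    proof (cases "W' = W")
      case False
      then have "v1 \<notin> W'" using partition_on_eq[OF part that W(1) _ W(2)] by blast
      then have "\<not> ends G e \<subseteq> W'" using ends_edge by simp
      then show ?thesis using conn[OF that] by (simp add: induced_delete_edge)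
    qed (use c in simp)
    then show False using nconn part by (simp add: connected_partition_def)
  qed
  moreover have "connected_mg (induced (delete_edge G e) W)" if "(v1, v2) \<in> ?A\<^sup>*"
  proof -
    have r: "(v1, w) \<in> ?A\<^sup>*" if "w \<in> W" for w
      using reach[OF that] \<open>(v1, v2) \<in> ?A\<^sup>*\<close> by (meson rtrancl_trans)
    have "(u, w) \<in> ?A\<^sup>*" if "u \<in> W" "w \<in> W" for u w
      using rtrancl_trans[OF adj_rtrancl_sym[OF r[OF that(1)]] r[OF that(2)]] .
    then show ?thesis using W(2) by (auto simp: connected_mg_def)
  qed
  ultimately have v12: "(v1, v2) \<notin> ?A\<^sup>*" by blast
  have disj: "K1 \<inter> K2 = {}"
  proof (rule ccontr)
    assume "K1 \<inter> K2 \<noteq> {}"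
    then obtain w where w: "(v1, w) \<in> ?A\<^sup>*" "(v2, w) \<in> ?A\<^sup>*"
      by (auto simp: K1_def K2_def component_without_def)
    then have "(v1, v2) \<in> ?A\<^sup>*" by (rule rtrancl_trans[OF _ adj_rtrancl_sym])
    then show False using v12 by simp
  qed
  define Q where "Q = P - {K1 \<union> K2} \<union> {K1, K2}"
  have partQ: "partition_on (verts G) Q"
    unfolding Q_def by (rule partition_on_split[OF part]) (use KW W(1) disj K in auto)
  have pQ: "part Q v1 = K1" "part Q v2 = K2"
    using part_eq[OF partQ _ K(1)] part_eq[OF partQ _ K(2)] by (simp_all add: Q_def)
  \<comment> \<open>Otherwise merging, which removes \<open>K1\<close> and \<open>K2\<close> from
    \<open>Q\<close>, would also lose an original part of \<open>P\<close>.\<close>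
  have notP: "K1 \<notin> P" "K2 \<notin> P"
  proof -
    show "K1 \<notin> P"
      using partition_on_eq[OF part _ W(1) K(1) W(2)] K(2) disj v2W by blast
    show "K2 \<notin> P"
      using partition_on_eq[OF part _ W(1) K(2) v2W] K(1) disj W(2) by blast
  qed
  have merge: "merge_parts v1 v2 Q = P"
    unfolding merge_parts_def pQ using notP W(1) KW by (auto simp: Q_def)
  have "connected_mg (induced G W')" if "W' \<in> Q" for W'
    using that conn connected_induced_component[OF W(2), of G e]
      connected_induced_component[OF v2W, of G e] by (auto simp: Q_def K1_def K2_def)
  then have connQ: "connected_partition G Q"
    using partQ by (simp add: connected_partition_def)
  have eQ: "e \<notin> inner_edges G Q"
  proof
    assume "e \<in> inner_edges G Q"
    then obtain U where "U \<in> Q" "v1 \<in> U" "v2 \<in> U" by (auto simp: edge_inner_iff)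
    then have "K1 = U" "K2 = U" using part_eq[OF partQ] pQ by blast+
    then show False using disj K by auto
  qed
  \<comment> \<open>An edge inside \<open>W\<close> other than \<open>e\<close> cannot cross between
    the two components, so splitting loses \<open>e\<close> only.\<close>
  have "inner_edges G P = insert e (inner_edges G Q)"
  proof (intro equalityI subsetI)
    fix f assume f: "f \<in> inner_edges G P"
    then obtain W' where fG: "f \<in> edges G" and W': "W' \<in> P" "ends G f \<subseteq> W'"
      by (auto simp: inner_edges_def)
    obtain a b where ab: "ends G f = {a, b}" using ends_wf[OF fG] by blast
    show "f \<in> insert e (inner_edges G Q)"
    proof (cases "W' = W \<and> f \<noteq> e")
      case True
      then have "(a, b) \<in> ?A" using fG ab W' by (auto simp: adj_def)
      moreover have "(b, a) \<in> ?A" using calculation sym_adj by (meson symE)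
      ultimately have "a \<in> K1 \<longleftrightarrow> b \<in> K1" "a \<in> K2 \<longleftrightarrow> b \<in> K2"
        using True W'(2) ab
        by (auto simp: K1_def K2_def component_without_def intro: rtrancl_into_rtrancl)
      moreover have "a \<in> K1 \<or> a \<in> K2" using True W'(2) ab KW by auto
      ultimately have "ends G f \<subseteq> K1 \<or> ends G f \<subseteq> K2" using ab by auto
      then show ?thesis using fG by (auto simp: inner_edges_def Q_def)
    next
      case False
      then show ?thesis using W' fG KW by (auto simp: inner_edges_def Q_def)
    qed
  next
    fix f assume f: "f \<in> insert e (inner_edges G Q)"
    have "\<exists>U\<in>P. U' \<subseteq> U" if "U' \<in> Q" for U'
      using that W(1) KW by (auto simp: Q_def)
    then have "inner_edges G Q \<subseteq> inner_edges G P"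
      unfolding inner_edges_def by (smt (verit) Collect_mono subset_trans)
    then show "f \<in> inner_edges G P" using e f by auto
  qed
  then have "Q \<in> separating"
    using connQ eQ merge by (simp add: separating_def)
  then show ?thesis using merge by (rule that)
qed

text \<open>Injectivity: the parts of \<open>v1\<close> and \<open>v2\<close> are the components of
  the merged part without \<open>e\<close>, and all other parts are untouched. Surjectivity is the
  splitting above.\<close>

lemma bij_betw_merge_parts: "bij_betw (merge_parts v1 v2) separating disconnecting"
  unfolding bij_betw_def
proof
  show "inj_on (merge_parts v1 v2) separating"
  proof (rule inj_onI)
    fix P Q assume P: "P \<in> separating" and Q: "Q \<in> separating"
      and eq: "merge_parts v1 v2 P = merge_parts v1 v2 Q"
    have facts: "partition_on (verts G) P" "e \<notin> inner_edges G P"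
      "partition_on (verts G) Q" "e \<notin> inner_edges G Q"
      using P Q by (auto simp: separating_def connected_partition_def)
    have union: "part P v1 \<union> part P v2 = part Q v1 \<union> part Q v2"
      using merge_parts_facts(2)[OF facts(1,2)] merge_parts_facts(2)[OF facts(3,4)] eq by simp
    have parts: "part P v1 = part Q v1" "part P v2 = part Q v2"
      using component_eq_part[OF P] component_eq_part[OF Q] union by (metis insertCI)+
    have "R = merge_parts v1 v2 R - {part R v1 \<union> part R v2} \<union> {part R v1, part R v2}"
      if "partition_on (verts G) R" "e \<notin> inner_edges G R" for R
      using merge_parts_facts(3)[OF that] part_in(1)[OF that(1)] ends_in_verts
      by (auto simp: merge_parts_def)
    then show "P = Q" using facts eq union parts by metis
  qed
  show "merge_parts v1 v2 ` separating = disconnecting"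
  proof (intro equalityI subsetI)
    fix P assume "P \<in> disconnecting"
    then show "P \<in> merge_parts v1 v2 ` separating"
      using split_disconnecting by (metis imageI)
  qed (use merge_parts_disconnecting in blast)
qed

text \<open>Identifying the two sinks turns the partition graph without \<open>e\<close> into that
  of the merged partition: no further edge disappears, since \<open>e\<close> was the only one
  between the two parts.\<close>

lemma card_two_sinks_merge:
  assumes P: "P \<in> separating"
  shows "card (sink_orientations (partition_graph (delete_edge G e) P) {part P v1, part P v2}) =
    card (sink_orientations (partition_graph G (merge_parts v1 v2 P))
      {part (merge_parts v1 v2 P) v1})"
proof -
  have part: "partition_on (verts G) P" and e: "e \<notin> inner_edges G P"
    and inner: "inner_edges G (merge_parts v1 v2 P) = insert e (inner_edges G P)"
    using P by (auto simp: separating_def connected_partition_def)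
  note p1 = part_in[OF part ends_in_verts(1)] and p2 = part_in[OF part ends_in_verts(2)]
  note M = merge_parts_facts[OF part e]
  let ?W1 = "part P v1" and ?W2 = "part P v2"
  define \<phi> where "\<phi> W = (if W \<in> {?W1, ?W2} then ?W1 \<union> ?W2 else W)" for W
  have img: "merge_parts v1 v2 P = \<phi> ` P"
    using p1(1) p2(1) by (auto simp: merge_parts_def \<phi>_def image_iff)
  show ?thesis
    unfolding M(2)
  proof (rule card_sink_orientations_collapse[where \<phi> = \<phi>])
    show "finite_multigraph (partition_graph (delete_edge G e) P)"
      by (rule finite_multigraph_partition_graph)
        (use finite_multigraph_delete_edge[OF finite_multigraph_axioms] part in simp_all)
    show "edges (partition_graph G (merge_parts v1 v2 P)) =
        edges (partition_graph (delete_edge G e) P)"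
      by (auto simp: inner inner_edges_delete_edge)
    show "verts (partition_graph G (merge_parts v1 v2 P)) =
        \<phi> ` verts (partition_graph (delete_edge G e) P)"
      by (simp add: img)
    show "ends (partition_graph G (merge_parts v1 v2 P)) f =
        \<phi> ` ends (partition_graph (delete_edge G e) P) f" for f
    proof (intro equalityI subsetI)
      fix U assume "U \<in> ends (partition_graph G (merge_parts v1 v2 P)) f"
      then have U: "U \<in> merge_parts v1 v2 P" "U \<inter> ends G f \<noteq> {}" by simp_all
      show "U \<in> \<phi> ` ends (partition_graph (delete_edge G e) P) f"
      proof (cases "U = ?W1 \<union> ?W2")
        case True
        then obtain W where "W \<in> {?W1, ?W2}" "W \<inter> ends G f \<noteq> {}" using U(2) by blast
        then show ?thesis
          using p1(1) p2(1) True by (intro image_eqI[of _ _ W]) (auto simp: \<phi>_def)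
      next
        case False
        then show ?thesis
          using U by (intro image_eqI[of _ _ U]) (auto simp: \<phi>_def merge_parts_def)
      qed
    next
      fix U assume "U \<in> \<phi> ` ends (partition_graph (delete_edge G e) P) f"
      then obtain W where W: "W \<in> P" "W \<inter> ends G f \<noteq> {}" "U = \<phi> W" by auto
      moreover have "W \<subseteq> \<phi> W" by (auto simp: \<phi>_def)
      ultimately show "U \<in> ends (partition_graph G (merge_parts v1 v2 P)) f"
        unfolding img by auto
    qed
    show "{?W1, ?W2} \<subseteq> verts (partition_graph (delete_edge G e) P)" using p1 p2 by simp
    show "\<phi> ` {?W1, ?W2} = {?W1 \<union> ?W2}" by (simp add: \<phi>_def)
    \<comment> \<open>The union is not a part of \<open>P\<close>, so no third part is sent to
      it.\<close>
    show "W \<in> {?W1, ?W2}"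
      if "W \<in> verts (partition_graph (delete_edge G e) P)" "\<phi> W = ?W1 \<union> ?W2" for W
      using that M(3) by (auto simp: \<phi>_def split: if_splits)
    show "inj_on \<phi> (verts (partition_graph (delete_edge G e) P) - {?W1, ?W2})"
      by (auto simp: inj_on_def \<phi>_def)
  qed
qed

text \<open>A second edge between the two parts would have its tail at one of the two sinks.\<close>

lemma no_two_sinks:
  assumes P: "connected_partition G P" "e \<notin> inner_edges G P" "P \<notin> separating"
  shows "sink_orientations (partition_graph (delete_edge G e) P) {part P v1, part P v2} = {}"
proof (rule equals0I)
  fix d assume d: "d \<in> sink_orientations (partition_graph (delete_edge G e) P)
    {part P v1, part P v2}"
  let ?W1 = "part P v1" and ?W2 = "part P v2"
  have part: "partition_on (verts G) P" using P(1) by (simp add: connected_partition_def)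
  note p1 = part_in[OF part ends_in_verts(1)] and p2 = part_in[OF part ends_in_verts(2)]
  \<comment> \<open>Merging never loses inner edges, so a partition that is not separating has an
    edge \<open>f\<close> besides \<open>e\<close> between the two parts.\<close>
  have "insert e (inner_edges G P) \<subseteq> inner_edges G (merge_parts v1 v2 P)"
  proof -
    have "\<exists>U\<in>merge_parts v1 v2 P. W \<subseteq> U" if "W \<in> P" for W
      using that by (auto simp: merge_parts_def)
    then have "inner_edges G P \<subseteq> inner_edges G (merge_parts v1 v2 P)"
      unfolding inner_edges_def by (smt (verit) Collect_mono subset_trans)
    then show ?thesis
      using edge ends_edge p1(2) p2(2) by (auto simp: inner_edges_def merge_parts_def)
  qed
  then obtain f where f: "f \<in> inner_edges G (merge_parts v1 v2 P)" "f \<noteq> e"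
    "f \<notin> inner_edges G P"
    using P by (auto simp: separating_def)
  have fG: "f \<in> edges G" using f(1) by (simp add: inner_edges_def)
  have sub: "ends G f \<subseteq> ?W1 \<union> ?W2"
    using f(1,3) by (auto simp: inner_edges_def merge_parts_def)
  have fd: "f \<in> edges (partition_graph (delete_edge G e) P)"
    using fG f(2,3) by (simp add: inner_edges_delete_edge)
  have "fst (d f) \<in> ends (partition_graph (delete_edge G e) P) f"
    using orientation_ends[OF sink_orientationsD(1)[OF d] fd] by (metis insertI1)
  then have "fst (d f) \<in> P" "fst (d f) \<inter> ends G f \<noteq> {}" by simp_all
  then obtain a where "fst (d f) \<in> P" "a \<in> fst (d f)" "a \<in> ?W1 \<union> ?W2" using sub by blast
  then have "fst (d f) \<in> {?W1, ?W2}"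
    using partition_on_eq[OF part] p1(1) p2(1) by (metis UnE insertCI)
  then show False using not_fst_sink[OF d fd] by blast
qed

end

section \<open>The contraction\<close>

text \<open>The merged vertex may be new or an end of \<open>e\<close>; any other vertex as its name
  would make \<open>g\<close> identify more than \<open>v1\<close> and \<open>v2\<close>.\<close>

locale edge_contraction = multigraph_edge +
  fixes x :: 'a
  assumes name: "x \<notin> verts G - {v1, v2}"
begin

abbreviation "G' \<equiv> contract_edge G e x"

definition g :: "'a \<Rightarrow> 'a" where
  "g v = (if v \<in> {v1, v2} then x else v)"

lemma contract_simps:
  "verts G' = g ` verts G" "edges G' = edges G - {e}" "ends G' f = g ` ends G f"
  using ends_in_verts by (auto simp: contract_edge_def g_def ends_edge)

lemma g_eqD:
  assumes "g a = g b" "a \<in> verts G" "b \<in> verts G"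
  shows "a = b \<or> a \<in> {v1, v2} \<and> b \<in> {v1, v2}"
  using assms name by (auto simp: g_def split: if_splits)

text \<open>Among the vertices of \<open>G\<close>, a set with both or neither end of
  \<open>e\<close> is a union of fibres of \<open>g\<close>.\<close>

lemma saturated:
  assumes "W \<subseteq> verts G" "v1 \<in> W \<longleftrightarrow> v2 \<in> W" "u \<in> verts G" "g u \<in> g ` W"
  shows "u \<in> W"
proof -
  obtain w where w: "w \<in> W" "g u = g w" using assms(4) by auto
  then have "u = w \<or> u \<in> {v1, v2} \<and> w \<in> {v1, v2}" using g_eqD assms(1,3) by blast
  then show ?thesis using w(1) assms(2) by auto
qed

lemma finite_multigraph_contract: "finite_multigraph G'"
proof
  show "finite (verts G')" "finite (edges G')"
    using finite_verts finite_edges by (simp_all add: contract_simps)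
  fix f assume "f \<in> edges G'"
  then have "f \<in> edges G" by (simp add: contract_simps)
  then obtain u w where "u \<in> verts G" "w \<in> verts G" "ends G f = {u, w}"
    using ends_wf by blast
  then show "\<exists>u\<in>verts G'. \<exists>w\<in>verts G'. ends G' f = {u, w}"
    by (intro bexI[of _ "g u"] bexI[of _ "g w"]) (simp_all add: contract_simps)
qed

lemma card_verts_contract: "card (verts G) = card (verts G') + 1"
proof -
  have "card (verts G') = card (verts G - {v1, v2}) + 1"
    using finite_verts name by (simp add: contract_edge_def ends_edge)
  moreover have "card (verts G - {v1, v2}) = card (verts G) - card {v1, v2}"
    by (rule card_Diff_subset) (use ends_in_verts in auto)
  moreover have "card {v1, v2} \<le> card (verts G)"
    by (rule card_mono[OF finite_verts]) (use ends_in_verts in auto)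
  ultimately show ?thesis using distinct by simp
qed

text \<open>When a path is pushed forward, \<open>e\<close> becomes a step that stays in place. When
  one is pulled back, each edge lifts into \<open>W\<close>, and lifts meeting at different points
  of the fibre over \<open>x\<close> are linked by \<open>e\<close> itself.\<close>

lemma connected_contract_iff:
  assumes W: "W \<subseteq> verts G" "v1 \<in> W \<longleftrightarrow> v2 \<in> W"
  shows "connected_mg (induced G' (g ` W)) \<longleftrightarrow> connected_mg (induced G W)"
proof -
  let ?A = "adj (induced G W)" and ?A' = "adj (induced G' (g ` W))"
  have push: "(g u, g w) \<in> ?A'\<^sup>*" if "(u, w) \<in> ?A\<^sup>*" for u w
    using that
  proof induction
    case (step y z)
    then obtain f where f: "f \<in> edges G" "ends G f = {y, z}" "{y, z} \<subseteq> W"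
      by (auto simp: adj_def)
    show ?case
    proof (cases "f = e")
      case True
      then have "g y = g z" using f(2) ends_edge by (auto simp: g_def doubleton_eq_iff)
      then show ?thesis using step.IH by simp
    next
      case False
      have "g ` ends G f \<subseteq> g ` W" using f(2,3) by (simp add: image_mono)
      then have "f \<in> edges (induced G' (g ` W))" using False f(1) by (simp add: contract_simps)
      moreover have "ends (induced G' (g ` W)) f = {g y, g z}"
        using f(2) by (simp add: contract_simps)
      ultimately have "(g y, g z) \<in> ?A'" unfolding adj_def by blast
      with step.IH show ?thesis by (rule rtrancl_into_rtrancl)
    qed
  qed simp
  have fibre: "(a, b) \<in> ?A\<^sup>*" if ab: "a \<in> W" "b \<in> W" "g a = g b" for a b
  proof -
    consider "a = b" | "a \<noteq> b" "a \<in> {v1, v2}" "b \<in> {v1, v2}"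
      using g_eqD[OF ab(3)] ab(1,2) W(1) by blast
    then show ?thesis
    proof cases
      case 2
      then have "ends G e = {a, b}" using ends_edge by auto
      then have "(a, b) \<in> ?A" using edge ab(1,2) by (auto simp: adj_def)
      then show ?thesis by blast
    qed simp
  qed
  \<comment> \<open>All lifts of both end points are quantified over, since consecutive lifted edges
    may meet at different ends of \<open>e\<close>.\<close>
  have pull: "\<forall>u\<in>W. \<forall>w\<in>W. g u = p \<longrightarrow> g w = p' \<longrightarrow> (u, w) \<in> ?A\<^sup>*" if "(p, p') \<in> ?A'\<^sup>*" for p p'
    using that
  proof induction
    case base
    then show ?case using fibre by simp
  next
    case (step y z)
    show ?case
    proof (intro ballI impI)
      fix u w assume uw: "u \<in> W" "w \<in> W" "g u = p" "g w = z"
      obtain f where f: "f \<in> edges G" "g ` ends G f = {y, z}" "g ` ends G f \<subseteq> g ` W"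
        using step.hyps(2) by (auto simp: adj_def contract_simps)
      obtain a b where ab: "a \<in> verts G" "b \<in> verts G" "ends G f = {a, b}" "g a = y" "g b = z"
      proof -
        obtain a b where ab: "a \<in> verts G" "b \<in> verts G" "ends G f = {a, b}"
          using ends_wf[OF f(1)] by blast
        then have "g a = y \<and> g b = z \<or> g a = z \<and> g b = y"
          using f(2) by (auto simp: doubleton_eq_iff)
        then show ?thesis using that[OF ab] that[of b a] ab by (auto simp: insert_commute)
      qed
      have abW: "a \<in> W" "b \<in> W"
        using saturated[OF W ab(1)] saturated[OF W ab(2)] f(3) ab(3) by auto
      have "(u, a) \<in> ?A\<^sup>*" using step.IH uw abW ab(4) by blast
      moreover have "(a, b) \<in> ?A" using f(1) ab(3) abW by (auto simp: adj_def)
      moreover have "(b, w) \<in> ?A\<^sup>*" using fibre abW(2) uw(2,4) ab(5) by simp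
      ultimately show "(u, w) \<in> ?A\<^sup>*" by (meson rtrancl_into_rtrancl rtrancl_trans)
    qed
  qed
  show ?thesis
  proof
    assume c: "connected_mg (induced G' (g ` W))"
    have "(u, w) \<in> ?A\<^sup>*" if "u \<in> W" "w \<in> W" for u w
    proof -
      have "(g u, g w) \<in> ?A'\<^sup>*" using c that by (simp add: connected_mg_def)
      from pull[OF this] show ?thesis using that by blast
    qed
    then show "connected_mg (induced G W)" using c by (simp add: connected_mg_def)
  next
    assume "connected_mg (induced G W)"
    then show "connected_mg (induced G' (g ` W))"
      using push by (simp add: connected_mg_def)
  qed
qed

section \<open>Connected partitions of the contraction\<close>

definition "joining = {P. connected_partition G P \<and> e \<in> inner_edges G P}"

abbreviation "contract_parts \<equiv> image (image g)"

lemma joiningD: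
  assumes "P \<in> joining"
  shows "partition_on (verts G) P" "e \<in> inner_edges G P" "connected_partition G P"
    and "\<And>W. W \<in> P \<Longrightarrow> W \<subseteq> verts G"
    and "\<And>W. W \<in> P \<Longrightarrow> v1 \<in> W \<longleftrightarrow> v2 \<in> W"
proof -
  show part: "partition_on (verts G) P" and e: "e \<in> inner_edges G P" and "connected_partition G P"
    using assms by (auto simp: joining_def connected_partition_def)
  show "W \<subseteq> verts G" if "W \<in> P" for W
    using partition_onD1[OF part] that by auto
  show "v1 \<in> W \<longleftrightarrow> v2 \<in> W" if "W \<in> P" for W
    using inner_part_both[OF part e that] .
qed

text \<open>This carries both the disjointness of parts and the incidence of edges with parts over
  to the contraction.\<close>

lemma joining_meet:
  assumes P: "P \<in> joining" and "W \<in> P" "X \<subseteq> verts G" "g ` W \<inter> g ` X \<noteq> {}"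
  shows "W \<inter> X \<noteq> {}"
proof -
  obtain p where "p \<in> g ` W" "p \<in> g ` X" using assms(4) by blast
  then obtain a where "a \<in> X" "g a \<in> g ` W" by (metis imageE)
  moreover from this have "a \<in> verts G" using assms(3) by blast
  ultimately have "a \<in> W"
    using saturated[OF joiningD(4)[OF P assms(2)] joiningD(5)[OF P assms(2)]] by simp
  with \<open>a \<in> X\<close> show ?thesis by blast
qed

lemma joining_vimage:
  assumes P: "P \<in> joining" and "W \<in> P"
  shows "verts G \<inter> g -` (g ` W) = W"
proof (intro equalityI subsetI)
  fix u assume "u \<in> verts G \<inter> g -` (g ` W)"
  then show "u \<in> W" using saturated[OF joiningD(4)[OF assms] joiningD(5)[OF assms]] by simp
qed (use joiningD(4)[OF assms] in auto)

lemma contract_parts_connected: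
  assumes P: "P \<in> joining"
  shows "connected_partition G' (contract_parts P)"
proof -
  note J = joiningD[OF P]
  have "partition_on (g ` verts G) (contract_parts P)"
  proof (rule partition_onI)
    show "\<Union> (contract_parts P) = g ` verts G" using partition_onD1[OF J(1)] by auto
    show "{} \<notin> contract_parts P" using partition_onD3[OF J(1)] by auto
    fix U U' assume "U \<in> contract_parts P" "U' \<in> contract_parts P" "U \<noteq> U'"
    then obtain W W' where W: "W \<in> P" "W' \<in> P" "U = g ` W" "U' = g ` W'" "W \<noteq> W'" by blast
    then have "W \<inter> W' = {}" using partition_on_eq[OF J(1)] by blast
    then show "disjnt U U'"
      using joining_meet[OF P W(1) J(4)[OF W(2)]] W(3,4) by (auto simp: disjnt_def)
  qed
  then show ?thesis
    using J(3) connected_contract_iff[OF J(4,5)]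
    by (auto simp: connected_partition_def contract_simps)
qed

text \<open>The inverse takes preimages of parts under \<open>g\<close>. Such a preimage contains
  both ends of \<open>e\<close> or neither, so connectedness transfers; the one over the part of
  \<open>x\<close> contains both, which makes \<open>e\<close> inner.\<close>

lemma bij_betw_contract_parts:
  "bij_betw contract_parts joining {Q. connected_partition G' Q}"
proof (rule bij_betw_byWitness[where f' = "image (\<lambda>U. verts G \<inter> g -` U)"])
  show "\<forall>P\<in>joining. (\<lambda>U. verts G \<inter> g -` U) ` contract_parts P = P"
    using joining_vimage by (auto simp: image_image)
  show "contract_parts ` joining \<subseteq> {Q. connected_partition G' Q}"
    using contract_parts_connected by blast
  have img: "g ` (verts G \<inter> g -` U) = U" if "U \<subseteq> g ` verts G" for U
    using that by auto
  have sub: "U \<subseteq> g ` verts G" if "connected_partition G' Q" "U \<in> Q" for Q U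
    using that partition_onD1[of "verts G'" Q]
    by (auto simp: connected_partition_def contract_simps)
  show "\<forall>Q\<in>{Q. connected_partition G' Q}. contract_parts ((\<lambda>U. verts G \<inter> g -` U) ` Q) = Q"
    using img sub by (simp add: image_image)
  show "(`) (\<lambda>U. verts G \<inter> g -` U) ` {Q. connected_partition G' Q} \<subseteq> joining"
  proof (intro image_subsetI)
    fix Q assume "Q \<in> {Q. connected_partition G' Q}"
    then have Q: "connected_partition G' Q" by simp
    then have part: "partition_on (g ` verts G) Q"
      by (simp add: connected_partition_def contract_simps)
    let ?P = "(\<lambda>U. verts G \<inter> g -` U) ` Q"
    have "partition_on (verts G) ?P"
    proof (rule partition_onI)
      show "\<Union> ?P = verts G" using partition_onD1[OF part] by auto
      show "{} \<notin> ?P"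
      proof
        assume "{} \<in> ?P"
        then obtain U where U: "U \<in> Q" "verts G \<inter> g -` U = {}" by blast
        then have "U = {}" using img[OF sub[OF Q U(1)]] by simp
        then show False using U(1) partition_onD3[OF part] by simp
      qed
      fix p q assume "p \<in> ?P" "q \<in> ?P" "p \<noteq> q"
      then show "disjnt p q"
        using partition_on_eq[OF part] by (auto simp: disjnt_iff)
    qed
    moreover have "connected_mg (induced G (verts G \<inter> g -` U))" if "U \<in> Q" for U
    proof -
      have "v1 \<in> verts G \<inter> g -` U \<longleftrightarrow> v2 \<in> verts G \<inter> g -` U"
        using ends_in_verts by (simp add: g_def)
      moreover have "connected_mg (induced G' (g ` (verts G \<inter> g -` U)))"
        using Q that img[OF sub[OF Q that]] by (simp add: connected_partition_def)
      ultimately show ?thesis using connected_contract_iff[of "verts G \<inter> g -` U"] by blast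
    qed
    moreover have "e \<in> inner_edges G ?P"
    proof -
      have "x \<in> g ` verts G" using ends_in_verts by (auto simp: g_def image_iff)
      then obtain U where "U \<in> Q" "x \<in> U" using partition_onD1[OF part] by auto
      then show ?thesis
        using ends_in_verts by (auto simp: edge_inner_iff g_def)
    qed
    ultimately show "?P \<in> joining"
      by (auto simp: joining_def connected_partition_def)
  qed
qed

lemma inner_edges_contract:
  assumes P: "P \<in> joining"
  shows "inner_edges G' (contract_parts P) = inner_edges G P - {e}"
proof -
  have iff: "g ` ends G f \<subseteq> g ` W \<longleftrightarrow> ends G f \<subseteq> W" if "f \<in> edges G" "W \<in> P" for f W
    using saturated[OF joiningD(4)[OF P that(2)] joiningD(5)[OF P that(2)]]
      finite_multigraph_ends_subset[OF finite_multigraph_axioms that(1)] by blast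
  have "(\<exists>U\<in>contract_parts P. g ` ends G f \<subseteq> U) \<longleftrightarrow> (\<exists>W\<in>P. ends G f \<subseteq> W)"
    if "f \<in> edges G" for f
    using iff[OF that] by (metis (no_types, lifting) image_iff)
  then show ?thesis
    unfolding inner_edges_def contract_simps by blast
qed

text \<open>\<open>g\<close> only renames the vertices of the partition graph, and \<open>e\<close>
  is an edge of neither version, so the orientation counts agree. The number of parts is unchanged
  while the vertex count drops by one, whence the sign.\<close>

lemma signed_term_contract:
  assumes P: "P \<in> joining"
  shows "signed_term G' x (contract_parts P) = - signed_term G v1 P"
proof -
  note J = joiningD[OF P]
  let ?W = "part P v1"
  note W = part_in[OF J(1) ends_in_verts(1)]
  have inj: "inj_on (image g) P"
    by (rule inj_onI) (metis joining_vimage[OF P])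
  have partQ: "partition_on (verts G') (contract_parts P)"
    using contract_parts_connected[OF P] by (simp add: connected_partition_def)
  have "x \<in> g ` ?W" using W(2) by (auto simp: g_def image_iff)
  then have part_x: "part (contract_parts P) x = g ` ?W"
    using part_eq[OF partQ] W(1) by blast
  have "card (sink_orientations (partition_graph G P) {?W}) =
      card (sink_orientations (partition_graph G' (contract_parts P)) {g ` ?W})"
  proof (rule card_sink_orientations_collapse[where \<phi> = "image g"])
    show "finite_multigraph (partition_graph G P)"
      by (rule finite_multigraph_partition_graph[OF finite_multigraph_axioms J(1)])
    show "edges (partition_graph G' (contract_parts P)) = edges (partition_graph G P)"
      using J(2) by (auto simp: inner_edges_contract[OF P] contract_simps)
    fix f assume "f \<in> edges (partition_graph G P)"
    then have sub: "ends G f \<subseteq> verts G"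
      using finite_multigraph_ends_subset[OF finite_multigraph_axioms] by simp
    have meet: "g ` W' \<inter> g ` ends G f \<noteq> {} \<longleftrightarrow> W' \<inter> ends G f \<noteq> {}"
      if "W' \<in> P" for W'
    proof
      assume "W' \<inter> ends G f \<noteq> {}"
      then obtain a where "a \<in> W'" "a \<in> ends G f" by blast
      then have "g a \<in> g ` W' \<inter> g ` ends G f" by simp
      then show "g ` W' \<inter> g ` ends G f \<noteq> {}" by (metis empty_iff)
    qed (rule joining_meet[OF P that sub])
    show "ends (partition_graph G' (contract_parts P)) f =
        contract_parts (ends (partition_graph G P) f)"
    proof (intro equalityI subsetI)
      fix U assume "U \<in> ends (partition_graph G' (contract_parts P)) f"
      then obtain W' where "W' \<in> P" "U = g ` W'" "g ` W' \<inter> g ` ends G f \<noteq> {}"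
        by (auto simp: contract_simps)
      then show "U \<in> contract_parts (ends (partition_graph G P) f)"
        using meet by simp
    next
      fix U assume "U \<in> contract_parts (ends (partition_graph G P) f)"
      then obtain W' where "W' \<in> P" "U = g ` W'" "W' \<inter> ends G f \<noteq> {}" by auto
      then show "U \<in> ends (partition_graph G' (contract_parts P)) f"
        using meet by (simp add: contract_simps)
    qed
  next
    show "W' \<in> {?W}" if "W' \<in> verts (partition_graph G P)" "g ` W' = g ` ?W" for W'
      using inj_onD[OF inj that(2)] that(1) W(1) by simp
    show "inj_on (image g) (verts (partition_graph G P) - {?W})"
      using inj by (rule inj_on_subset) auto
  qed (use W in simp_all)
  then show ?thesis
    using card_image[OF inj] card_verts_contract by (simp add: signed_term_def part_x)
qed

section \<open>Comparison of the signed sums\<close>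

lemma alternating_number_contract:
  "alternating_number G' x k =
    - sum (signed_term G v1) {P \<in> connected_partitions G (k + 1). e \<in> inner_edges G P}"
proof -
  let ?C = "{P \<in> connected_partitions G (k + 1). e \<in> inner_edges G P}"
  have C: "?C \<subseteq> joining" by (auto simp: joining_def connected_partitions_def)
  have bij: "bij_betw contract_parts ?C (connected_partitions G' k)"
  proof (rule bij_betw_subset[OF bij_betw_contract_parts C])
    \<comment> \<open>Contraction removes \<open>e\<close> from the inner edges, so index
      \<open>k\<close> in \<open>G'\<close> is index \<open>k + 1\<close> in
      \<open>G\<close>.\<close>
    have "int (card (inner_edges G' (contract_parts P))) = k \<longleftrightarrow>
        int (card (inner_edges G P)) = k + 1" if P: "P \<in> joining" for P
    proof -
      have "finite (inner_edges G P)" using finite_edges by (simp add: inner_edges_def)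
      then have "card (inner_edges G P) = Suc (card (inner_edges G P - {e}))"
        using card.remove[OF _ joiningD(2)[OF P]] by simp
      then show ?thesis using inner_edges_contract[OF P] by simp
    qed
    then have iff: "contract_parts P \<in> connected_partitions G' k \<longleftrightarrow> P \<in> ?C"
      if "P \<in> joining" for P
      using that contract_parts_connected[OF that] joiningD(2,3)[OF that]
      by (simp add: connected_partitions_def)
    show "contract_parts ` ?C = connected_partitions G' k"
    proof (intro equalityI subsetI)
      fix Q assume Q: "Q \<in> connected_partitions G' k"
      then have "Q \<in> contract_parts ` joining"
        using bij_betw_imp_surj_on[OF bij_betw_contract_parts]
        by (simp add: connected_partitions_def)
      then show "Q \<in> contract_parts ` ?C" using iff Q by blast
    qed (use iff C in blast)
  qed
  have "x \<in> verts G'" by (simp add: contract_edge_def)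
  then have "alternating_number G' x k = sum (signed_term G' x) (connected_partitions G' k)"
    by (rule alternating_number_eq_sum[OF finite_multigraph_contract])
  also have "\<dots> = (\<Sum>P\<in>?C. signed_term G' x (contract_parts P))"
    by (rule sum.reindex_bij_betw[OF bij, symmetric])
  also have "\<dots> = (\<Sum>P\<in>?C. - signed_term G v1 P)"
    using C signed_term_contract by (intro sum.cong) auto
  finally show ?thesis by (simp add: sum_negf)
qed

text \<open>If \<open>e\<close> is inner, deletion lowers the number of inner edges by one and may
  destroy connectedness; otherwise it changes neither that number nor the induced subgraphs.\<close>

lemma connected_partitions_delete_edge:
  "connected_partitions (delete_edge G e) k =
    {P \<in> connected_partitions G k. e \<notin> inner_edges G P} \<union>
    {P \<in> connected_partitions G (k + 1). e \<in> inner_edges G P \<and>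
      connected_partition (delete_edge G e) P}"
proof -
  have card: "int (card (inner_edges G P - {e})) = k \<longleftrightarrow>
      int (card (inner_edges G P)) = (if e \<in> inner_edges G P then k + 1 else k)" for P
  proof -
    have "finite (inner_edges G P)" using finite_edges by (simp add: inner_edges_def)
    then have "card (inner_edges G P) = Suc (card (inner_edges G P - {e}))"
      if "e \<in> inner_edges G P"
      using card.remove[OF _ that] by simp
    then show ?thesis by auto
  qed
  show ?thesis
    using connected_partition_delete_edgeD[of G e] connected_partition_delete_edge_iff[OF edge]
    unfolding connected_partitions_def inner_edges_delete_edge card by auto
qed

text \<open>The recurrence along \<open>e\<close> turns each difference into a count with two sinks,
  which vanishes unless the partition is separating. Merging then gives one part fewer, hence the
  minus sign, and one inner edge more, hence \<open>k + 1\<close>.\<close>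

lemma sum_two_sinks:
  "(\<Sum>P | P \<in> connected_partitions G k \<and> e \<notin> inner_edges G P.
      signed_term G v1 P - signed_term (delete_edge G e) v1 P) =
    - (\<Sum>P | P \<in> connected_partitions G (k + 1) \<and> P \<in> disconnecting. signed_term G v1 P)"
proof -
  let ?O = "{P. P \<in> connected_partitions G k \<and> e \<notin> inner_edges G P}"
  let ?D = "{P. P \<in> connected_partitions G (k + 1) \<and> P \<in> disconnecting}"
  let ?S = "{P. P \<in> connected_partitions G k \<and> P \<in> separating}"
  let ?s = "\<lambda>P. sink_orientations (partition_graph (delete_edge G e) P) {part P v1, part P v2}"
  have diff: "signed_term G v1 P - signed_term (delete_edge G e) v1 P =
      (-1) ^ (card (verts G) + card P) * int (card (?s P))" if P: "P \<in> ?O" for P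
  proof -
    have part: "partition_on (verts G) P" using P connected_partitionsD(1) by blast
    note p1 = part_in[OF part ends_in_verts(1)] and p2 = part_in[OF part ends_in_verts(2)]
    have "ends (partition_graph G P) e = {part P v1, part P v2}"
    proof (intro equalityI subsetI)
      fix W assume "W \<in> ends (partition_graph G P) e"
      then have "W \<in> P" "v1 \<in> W \<or> v2 \<in> W" by (auto simp: ends_edge)
      then show "W \<in> {part P v1, part P v2}" using part_eq[OF part] by blast
    next
      fix W assume "W \<in> {part P v1, part P v2}"
      then show "W \<in> ends (partition_graph G P) e" using p1 p2 by (auto simp: ends_edge)
    qed
    moreover have "e \<in> edges (partition_graph G P)" using edge P by simp
    moreover have "part P v1 \<noteq> part P v2" using not_inner_parts[OF part] P by blast
    ultimately have "card (sink_orientations (partition_graph G P) {part P v1}) =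
        card (sink_orientations (partition_graph (delete_edge G e) P) {part P v1}) + card (?s P)"
      unfolding partition_graph_delete_edge
      by (intro card_sink_orientations_delete_edge
          finite_multigraph_partition_graph[OF finite_multigraph_axioms part])
    then show ?thesis by (simp add: signed_term_def algebra_simps)
  qed
  have bij: "bij_betw (merge_parts v1 v2) ?S ?D"
  proof (rule bij_betw_subset[OF bij_betw_merge_parts])
    have iff: "merge_parts v1 v2 P \<in> ?D \<longleftrightarrow> P \<in> ?S" if P: "P \<in> separating" for P
    proof -
      have "finite (inner_edges G P)" using finite_edges by (simp add: inner_edges_def)
      then have "card (inner_edges G (merge_parts v1 v2 P)) = Suc (card (inner_edges G P))"
        using P by (simp add: separating_def)
      then show ?thesis
        using P merge_parts_disconnecting[OF P]
        by (auto simp: connected_partitions_def separating_def disconnecting_def)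
    qed
    show "merge_parts v1 v2 ` ?S = ?D"
    proof (intro equalityI subsetI)
      fix Q assume Q: "Q \<in> ?D"
      then obtain P where "P \<in> separating" "merge_parts v1 v2 P = Q"
        using split_disconnecting by blast
      then show "Q \<in> merge_parts v1 v2 ` ?S" using iff Q by blast
    qed (use iff in blast)
  qed auto
  have merge: "(-1) ^ (card (verts G) + card P) * int (card (?s P)) =
      - signed_term G v1 (merge_parts v1 v2 P)" if P: "P \<in> ?S" for P
  proof -
    have "partition_on (verts G) P" "e \<notin> inner_edges G P"
      using P by (auto simp: separating_def connected_partition_def)
    from merge_parts_facts(4)[OF this] have "card P = card (merge_parts v1 v2 P) + 1" by simp
    then show ?thesis using card_two_sinks_merge P by (simp add: signed_term_def)
  qed
  have "(\<Sum>P\<in>?O. signed_term G v1 P - signed_term (delete_edge G e) v1 P) =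
      (\<Sum>P\<in>?O. (-1) ^ (card (verts G) + card P) * int (card (?s P)))"
    by (rule sum.cong) (simp_all only: diff)
  also have "\<dots> = (\<Sum>P\<in>?S. (-1) ^ (card (verts G) + card P) * int (card (?s P)))"
  proof (rule sum.mono_neutral_right)
    show "finite ?O" using finite_connected_partitions[OF finite_multigraph_axioms] by simp
    show "?S \<subseteq> ?O" by (auto simp: separating_def)
    have "?s P = {}" if "P \<in> ?O - ?S" for P
      by (rule no_two_sinks) (use that connected_partitionsD(2) in auto)
    then show "\<forall>P\<in>?O - ?S. (-1) ^ (card (verts G) + card P) * int (card (?s P)) = 0"
      by simp
  qed
  also have "\<dots> = (\<Sum>P\<in>?S. - signed_term G v1 (merge_parts v1 v2 P))"
    by (rule sum.cong) (simp_all only: merge)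
  also have "\<dots> = (\<Sum>P\<in>?D. - signed_term G v1 P)"
    by (rule sum.reindex_bij_betw[OF bij])
  finally show ?thesis by (simp add: sum_negf)
qed

lemma alternating_number_deletion_contraction:
  "alternating_number G v1 k + alternating_number G' x (k - 1) =
    alternating_number G' x k + alternating_number (delete_edge G e) v1 k"
proof -
  let ?T = "signed_term G v1" and ?T' = "signed_term (delete_edge G e) v1"
  let ?I = "\<lambda>k. {P \<in> connected_partitions G k. e \<in> inner_edges G P}"
  let ?O = "{P \<in> connected_partitions G k. e \<notin> inner_edges G P}"
  let ?K = "{P \<in> connected_partitions G (k + 1). e \<in> inner_edges G P \<and>
      connected_partition (delete_edge G e) P}"
  let ?D = "{P \<in> connected_partitions G (k + 1). P \<in> disconnecting}"
  have fin: "finite (connected_partitions G j)" for j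
    by (rule finite_connected_partitions[OF finite_multigraph_axioms])
  have "alternating_number G v1 k = sum ?T (?I k \<union> ?O)"
    unfolding alternating_number_eq_sum[OF finite_multigraph_axioms ends_in_verts(1)]
    by (rule sum.cong) auto
  also have "\<dots> = sum ?T (?I k) + sum ?T ?O"
    by (rule sum.union_disjoint) (use fin in auto)
  finally have A: "alternating_number G v1 k = sum ?T (?I k) + sum ?T ?O" .
  \<comment> \<open>\<open>e\<close> lies inside a part, so deleting it does not change the
    partition graph.\<close>
  have "?T' P = ?T P" if "P \<in> ?K" for P
  proof -
    have "partition_graph (delete_edge G e) P = partition_graph G P"
      using that edge by (auto simp: partition_graph_def inner_edges_def)
    then show ?thesis by (simp add: signed_term_def)
  qed
  then have "sum ?T' ?K = sum ?T ?K" by (intro sum.cong) auto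
  moreover have "alternating_number (delete_edge G e) v1 k = sum ?T' (?O \<union> ?K)"
    using alternating_number_eq_sum[OF finite_multigraph_delete_edge[OF finite_multigraph_axioms]]
      ends_in_verts(1) connected_partitions_delete_edge by simp
  moreover have "sum ?T' (?O \<union> ?K) = sum ?T' ?O + sum ?T' ?K"
    by (rule sum.union_disjoint) (use fin in auto)
  ultimately have B: "alternating_number (delete_edge G e) v1 k = sum ?T' ?O + sum ?T ?K"
    by simp
  have "sum ?T (?I (k + 1)) = sum ?T (?K \<union> ?D)"
    by (rule sum.cong) (auto simp: disconnecting_def connected_partitions_def)
  also have "\<dots> = sum ?T ?K + sum ?T ?D"
    by (rule sum.union_disjoint) (use fin in \<open>auto simp: disconnecting_def\<close>)
  finally have "sum ?T (?I (k + 1)) = sum ?T ?K + sum ?T ?D" .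
  moreover have "sum ?T ?O - sum ?T' ?O = - sum ?T ?D"
    using sum_two_sinks[of k] by (simp add: sum_subtractf)
  \<comment> \<open>On the left the two sums over \<open>?I k\<close> cancel, leaving
    \<open>sum ?T ?O\<close>; on the right \<open>sum ?T ?K\<close> cancels, leaving
    \<open>sum ?T' ?O - sum ?T ?D\<close>.\<close>
  ultimately show ?thesis
    using A B alternating_number_contract[of k] alternating_number_contract[of "k - 1"] by simp
qed

end

theorem proposition1p7:
  fixes G :: "('v, 'e) multigraph" and e :: 'e and v1 v2 x q q1 q2 :: 'v and k :: int
  assumes "finite_multigraph G"
    and "connected_mg G"
    and "e \<in> edges G"
    and "ends G e = {v1, v2}"
    and "v1 \<noteq> v2"
    and "\<not> bridge G e"
    and "x \<notin> verts G - {v1, v2}"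
    and "q \<in> verts G"
    and "q1 \<in> verts (contract_edge G e x)"
    and "q2 \<in> verts (delete_edge G e)"
  shows "alternating_number G q k + alternating_number (contract_edge G e x) q1 (k - 1) =
    alternating_number (contract_edge G e x) q1 k + alternating_number (delete_edge G e) q2 k"
proof -
  interpret edge_contraction G e v1 v2 x
    using assms by (simp add: edge_contraction_def multigraph_edge_def multigraph_edge_axioms_def
      edge_contraction_axioms_def)
  have x: "x \<in> verts G'" by (simp add: contract_edge_def)
  \<comment> \<open>The arbitrary roots are moved to \<open>v1\<close> and \<open>x\<close>, the
    vertices at which the identity was proved.\<close>
  have "alternating_number G q k = alternating_number G v1 k"
    by (rule alternating_number_root_independent[OF assms(1,8) ends_in_verts(1)])
  moreover have "alternating_number G' q1 j = alternating_number G' x j" for j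
    by (rule alternating_number_root_independent[OF finite_multigraph_contract assms(9) x])
  moreover have "alternating_number (delete_edge G e) q2 k =
      alternating_number (delete_edge G e) v1 k"
    by (rule alternating_number_root_independent[OF finite_multigraph_delete_edge[OF assms(1)]
          assms(10)]) (simp add: ends_in_verts(1))
  ultimately show ?thesis
    using alternating_number_deletion_contraction[of k] by simp
qed

end
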